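(* The matching $X^{\min}$, i.e. the minimal element of the lattice $(\mathcal{S},\prec_F)$ of stable matchings, can be constructed in time $O(|E|\,|V|)$ (including oracle calls), given the bipartite graph $G=(V=W\sqcup F,E)$, the linear orders $>_w$ ($w\in W$) and oracles for the choice functions $C_f$ ($f\in F$).
   Context: Setting. $G=(V,E)$ is a finite connected bipartite graph without multiple edges, with vertex parts $W$ and $F$; the edge joining $w\in W$ and $f\in F$ is denoted $wf$. $E_v$ is the set of edges incident to $v\in V$, and $X_v:=X\cap E_v$ for $X\subseteq E$. Each $w\in W$ has a strict linear order $>_w$ on $E_w$ ($e>_w e'$ means that $e$ is preferred to $e'$) and quota $q(w)=1$; accordingly $C_w(Z)$, for nonempty $Z\subseteq E_w$, is the one-element set formed by the $>_w$-largest element of $Z$, and $C_w(\emptyset)=\emptyset$. Each $f\in F$ has a choice function $C_f:2^{E_f}\to 2^{E_f}$ with $C_f(Z)\subseteq Z$, satisfying for all $Z,Z'\subseteq E_f$: (A1) if $Z\supseteq Z'\supseteq C_f(Z)$ then $C_f(Z')=C_f(Z)$; (A2) if $Z\supseteq Z'$ then $C_f(Z)\cap Z'\subseteq C_f(Z')$; (A3) if $Z\supseteq Z'$ then $|C_f(Z)|\ge |C_f(Z')|$. Stability. A matching is an arbitrary subset $X\subseteq E$. A set $Z\subseteq E_v$ is acceptable if $C_v(Z)=Z$; $X\subseteq E$ is acceptable if all $X_v$, $v\in V$, are. For acceptable $Z,Z'\subseteq E_v$, $Z\succeq_v Z'$ means $C_v(Z\cup Z')=Z$. For distinct acceptable matchings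 $X,Y$, $X\succ_F Y$ (also written $Y\prec_F X$) means $X_f\succeq_f Y_f$ for all $f\in F$. An acceptable $X$ is stable if there is no edge $e=wf\in E\setminus X$ with both $e\in C_w(X_w\cup\{e\})$ and $e\in C_f(X_f\cup\{e\})$. $\mathcal{S}$ is the set of stable matchings. It is known that $\mathcal{S}\neq\emptyset$ and $(\mathcal{S},\prec_F)$ is a distributive lattice; its minimal element is denoted $X^{\min}$ (it is the worst stable matching for $F$ and the best for $W$). Computational model. Each $C_f$ is given by an oracle that, asked about $Z\subseteq E_f$, returns $C_f(Z)$, each call counted as $O(1)$ time; time is the number of standard operations plus oracle calls. The linear orders $>_w$ are given as sorted lists. *)

theory Defs
  imports Main
begin

section \<open>Bipartite graphs with preferences and choice functions\<close>

text \<open>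
  An edge joining \<open>w\<close> and \<open>f\<close> is the pair \<open>(w, f)\<close>, so there are no multiple edges, and the
  vertex set is the disjoint sum of the two parts. The membership \<open>(e, e') \<in> pref M w\<close> means that
  \<open>w\<close> prefers \<open>e\<close> to \<open>e'\<close>.
\<close>

record ('w, 'f) market =
  wside :: "'w set"
  fside :: "'f set"
  edges :: "('w \<times> 'f) set"
  pref :: "'w \<Rightarrow> (('w \<times> 'f) \<times> ('w \<times> 'f)) set"
  choice :: "'f \<Rightarrow> ('w \<times> 'f) set \<Rightarrow> ('w \<times> 'f) set"

definition verts :: "('w, 'f) market \<Rightarrow> ('w + 'f) set" where
  "verts M = wside M <+> fside M"

fun edges_at :: "('w, 'f) market \<Rightarrow> 'w + 'f \<Rightarrow> ('w \<times> 'f) set" where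
  "edges_at M (Inl w) = {e \<in> edges M. fst e = w}"
| "edges_at M (Inr f) = {e \<in> edges M. snd e = f}"

definition connected_market :: "('w, 'f) market \<Rightarrow> bool" where
  "connected_market M \<longleftrightarrow>
     (let R = {(Inl w, Inr f) | w f. (w, f) \<in> edges M}
      in \<forall>u \<in> verts M. \<forall>v \<in> verts M. (u, v) \<in> (R \<union> R\<inverse>)\<^sup>*)"

definition valid_market :: "('w, 'f) market \<Rightarrow> bool" where
  "valid_market M \<longleftrightarrow>
     finite (wside M) \<and> finite (fside M) \<and>
     edges M \<subseteq> wside M \<times> fside M \<and>
     connected_market M \<and>
     (\<forall>w \<in> wside M. strict_linear_order_on (edges_at M (Inl w)) (pref M w)) \<and>
     (\<forall>f \<in> fside M. \<forall>Z \<subseteq> edges_at M (Inr f). choice M f Z \<subseteq> Z) \<and>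
     (\<forall>f \<in> fside M. \<forall>Z \<subseteq> edges_at M (Inr f). \<forall>Z' \<subseteq> edges_at M (Inr f).
        (Z' \<subseteq> Z \<and> choice M f Z \<subseteq> Z' \<longrightarrow> choice M f Z' = choice M f Z) \<and>
        (Z' \<subseteq> Z \<longrightarrow> choice M f Z \<inter> Z' \<subseteq> choice M f Z') \<and>
        (Z' \<subseteq> Z \<longrightarrow> card (choice M f Z') \<le> card (choice M f Z)))"

fun choice_at :: "('w, 'f) market \<Rightarrow> 'w + 'f \<Rightarrow> ('w \<times> 'f) set \<Rightarrow> ('w \<times> 'f) set" where
  "choice_at M (Inl w) Z = {e \<in> Z. \<forall>e' \<in> Z. e' \<noteq> e \<longrightarrow> (e, e') \<in> pref M w}"
| "choice_at M (Inr f) Z = choice M f Z"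


section \<open>Stable matchings\<close>

definition acceptable :: "('w, 'f) market \<Rightarrow> ('w \<times> 'f) set \<Rightarrow> bool" where
  "acceptable M X \<longleftrightarrow>
     X \<subseteq> edges M \<and> (\<forall>v \<in> verts M. choice_at M v (X \<inter> edges_at M v) = X \<inter> edges_at M v)"

definition weakly_prefers ::
    "('w, 'f) market \<Rightarrow> 'w + 'f \<Rightarrow> ('w \<times> 'f) set \<Rightarrow> ('w \<times> 'f) set \<Rightarrow> bool" where
  "weakly_prefers M v Z Z' \<longleftrightarrow> choice_at M v (Z \<union> Z') = Z"

definition prec_F :: "('w, 'f) market \<Rightarrow> ('w \<times> 'f) set \<Rightarrow> ('w \<times> 'f) set \<Rightarrow> bool" where
  "prec_F M Y X \<longleftrightarrow>
     acceptable M X \<and> acceptable M Y \<and> X \<noteq> Y \<and>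
     (\<forall>f \<in> fside M. weakly_prefers M (Inr f) (X \<inter> edges_at M (Inr f)) (Y \<inter> edges_at M (Inr f)))"

definition blocking :: "('w, 'f) market \<Rightarrow> ('w \<times> 'f) set \<Rightarrow> 'w \<times> 'f \<Rightarrow> bool" where
  "blocking M X e \<longleftrightarrow>
     e \<in> edges M - X \<and>
     e \<in> choice_at M (Inl (fst e)) (X \<inter> edges_at M (Inl (fst e)) \<union> {e}) \<and>
     e \<in> choice_at M (Inr (snd e)) (X \<inter> edges_at M (Inr (snd e)) \<union> {e})"

definition stable_matchings :: "('w, 'f) market \<Rightarrow> ('w \<times> 'f) set set" where
  "stable_matchings M = {X. acceptable M X \<and> \<not> (\<exists>e. blocking M X e)}"

text \<open>The minimal element of a finite lattice is its least element.\<close>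

definition is_X_min :: "('w, 'f) market \<Rightarrow> ('w \<times> 'f) set \<Rightarrow> bool" where
  "is_X_min M X \<longleftrightarrow>
     X \<in> stable_matchings M \<and> (\<forall>Y \<in> stable_matchings M. Y \<noteq> X \<longrightarrow> prec_F M X Y)"


section \<open>Random access programs with an oracle\<close>

text \<open>
  Structured programs for a unit-cost random access machine over the natural numbers. The memory
  consists of named arrays; a scalar variable \<open>x\<close> is the cell \<open>x[0]\<close>. The only arithmetic is
  addition and truncated subtraction (unit-cost multiplication of unbounded numbers would be
  unreasonably powerful). Each node of an evaluated expression, each elementary command, each test
  and each oracle call costs one unit of time.
\<close>

type_synonym vname = string
type_synonym state = "vname \<Rightarrow> nat \<Rightarrow> nat"

datatype aexp = Const nat | Cell vname aexp | Plus aexp aexp | Minus aexp aexp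

datatype bexp = Less aexp aexp | Equal aexp aexp | Not bexp | And bexp bexp

datatype com =
    Skip
  | Assign vname aexp aexp  \<comment> \<open>\<open>Assign x i a\<close> is \<open>x[i] := a\<close>\<close>
  | Seq com com
  | If bexp com com
  | While bexp com
  | Ask vname aexp vname    \<comment> \<open>\<open>Ask y a x\<close> puts query \<open>x\<close> to oracle number \<open>a\<close>, answer in \<open>y\<close>\<close>

fun aval :: "aexp \<Rightarrow> state \<Rightarrow> nat" where
  "aval (Const n) s = n"
| "aval (Cell x a) s = s x (aval a s)"
| "aval (Plus a b) s = aval a s + aval b s"
| "aval (Minus a b) s = aval a s - aval b s"

fun acost :: "aexp \<Rightarrow> nat" where
  "acost (Const n) = 1"
| "acost (Cell x a) = acost a + 1"
| "acost (Plus a b) = acost a + acost b + 1"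
| "acost (Minus a b) = acost a + acost b + 1"

fun bval :: "bexp \<Rightarrow> state \<Rightarrow> bool" where
  "bval (Less a b) s \<longleftrightarrow> aval a s < aval b s"
| "bval (Equal a b) s \<longleftrightarrow> aval a s = aval b s"
| "bval (Not b) s \<longleftrightarrow> \<not> bval b s"
| "bval (And b c) s \<longleftrightarrow> bval b s \<and> bval c s"

fun bcost :: "bexp \<Rightarrow> nat" where
  "bcost (Less a b) = acost a + acost b + 1"
| "bcost (Equal a b) = acost a + acost b + 1"
| "bcost (Not b) = bcost b + 1"
| "bcost (And b c) = bcost b + bcost c + 1"

text \<open>
  Queries, answers and the final output are length-prefixed lists: the length is in cell \<open>0\<close>, the
  entries are in the cells \<open>1, 2, \<dots>\<close>.
\<close>

definition read_list :: "(nat \<Rightarrow> nat) \<Rightarrow> nat list" where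
  "read_list g = map g [1..<Suc (g 0)]"

definition write_list :: "nat list \<Rightarrow> (nat \<Rightarrow> nat) \<Rightarrow> nat \<Rightarrow> nat" where
  "write_list xs g i =
     (if i = 0 then length xs else if i \<le> length xs then xs ! (i - 1) else g i)"

text \<open>
  \<open>exec orc p s t s'\<close>: with oracle \<open>orc\<close>, the program \<open>p\<close> started in state \<open>s\<close> halts after time \<open>t\<close>
  in state \<open>s'\<close>.
\<close>

inductive exec ::
    "(nat \<Rightarrow> nat list \<Rightarrow> nat list) \<Rightarrow> com \<Rightarrow> state \<Rightarrow> nat \<Rightarrow> state \<Rightarrow> bool"
  for orc :: "nat \<Rightarrow> nat list \<Rightarrow> nat list" where
  Skip: "exec orc Skip s 1 s"
| Assign: "exec orc (Assign x i a) s (acost i + acost a + 1) (s(x := (s x)(aval i s := aval a s)))"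
| Seq: "exec orc p s t s' \<Longrightarrow> exec orc q s' t' s'' \<Longrightarrow> exec orc (Seq p q) s (t + t') s''"
| IfTrue: "bval b s \<Longrightarrow> exec orc p s t s' \<Longrightarrow> exec orc (If b p q) s (bcost b + t + 1) s'"
| IfFalse: "\<not> bval b s \<Longrightarrow> exec orc q s t s' \<Longrightarrow> exec orc (If b p q) s (bcost b + t + 1) s'"
| WhileFalse: "\<not> bval b s \<Longrightarrow> exec orc (While b p) s (bcost b + 1) s"
| WhileTrue: "bval b s \<Longrightarrow> exec orc p s t s' \<Longrightarrow> exec orc (While b p) s' t' s'' \<Longrightarrow>
    exec orc (While b p) s (bcost b + t + t' + 1) s''"
| Ask: "exec orc (Ask y a x) s (acost a + 1)
    (s(y := write_list (orc (aval a s) (read_list (s x))) (s y)))"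

lemma exec_deterministic:
  assumes "exec orc p s t s'" and "exec orc p s u s''"
  shows "t = u \<and> s' = s''"
  using assms
proof (induction arbitrary: u s'' rule: exec.induct)
  case (Skip s)
  then show ?case by cases simp
next
  case (Assign x i a s)
  then show ?case by cases simp
next
  case (Seq p s t s' q t' s2)
  from Seq.prems show ?case by cases (use Seq.IH in blast)
next
  case (IfTrue b s p t s' q)
  from IfTrue.prems IfTrue.hyps show ?case by cases (use IfTrue.IH in blast)+
next
  case (IfFalse b s q t s' p)
  from IfFalse.prems IfFalse.hyps show ?case by cases (use IfFalse.IH in blast)+
next
  case (WhileFalse b s p)
  from WhileFalse.prems WhileFalse.hyps show ?case by cases simp_all
next
  case (WhileTrue b s p t s' t' s2)
  from WhileTrue.prems WhileTrue.hyps show ?case by cases (use WhileTrue.IH in blast)+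
next
  case (Ask y a x s)
  then show ?case by cases simp
qed


section \<open>Representation of the input\<close>

text \<open>
  The vertices of the two parts and the edges are numbered by their positions in lists \<open>ws\<close>, \<open>fs\<close>
  and \<open>es\<close>. A set of edges is represented by a repetition-free list, in any order, of edge numbers.
\<close>

definition represents :: "'e list \<Rightarrow> 'e set \<Rightarrow> nat list \<Rightarrow> bool" where
  "represents es Z zs \<longleftrightarrow> distinct zs \<and> set zs \<subseteq> {..<length es} \<and> (!) es ` set zs = Z"

text \<open>
  A list of lists is stored as its concatenation \<open>x\<close>, with the array \<open>off\<close> of starting positions:
  the \<open>i\<close>-th list occupies the cells \<open>off[i], \<dots>, off[i+1] - 1\<close> of \<open>x\<close>.
\<close>

definition stores_lists :: "state \<Rightarrow> vname \<Rightarrow> vname \<Rightarrow> nat list list \<Rightarrow> bool" where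
  "stores_lists s off x xss \<longleftrightarrow>
     (\<forall>i \<le> length xss. s off i = length (concat (take i xss))) \<and>
     (\<forall>k < length (concat xss). s x k = concat xss ! k)"

text \<open>
  The input consists of the numbers of vertices and edges, the end vertices of each edge, the lists
  of incident edges of the vertices in \<open>wside M\<close>, sorted with the most preferred edge first, and
  the lists of incident edges, in any order, of the vertices in \<open>fside M\<close>. All other memory cells
  have arbitrary contents.
\<close>

definition encodes ::
    "('w, 'f) market \<Rightarrow> 'w list \<Rightarrow> 'f list \<Rightarrow> ('w \<times> 'f) list \<Rightarrow> state \<Rightarrow> bool" where
  "encodes M ws fs es s \<longleftrightarrow>
     distinct ws \<and> set ws = wside M \<and> s ''nW'' 0 = length ws \<and>
     distinct fs \<and> set fs = fside M \<and> s ''nF'' 0 = length fs \<and>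
     distinct es \<and> set es = edges M \<and> s ''nE'' 0 = length es \<and>
     (\<forall>j < length es. s ''wend'' j < length ws \<and> s ''fend'' j < length fs \<and>
        es ! j = (ws ! s ''wend'' j, fs ! s ''fend'' j)) \<and>
     (\<exists>wlists. length wlists = length ws \<and> stores_lists s ''woff'' ''wadj'' wlists \<and>
        (\<forall>i < length ws. represents es (edges_at M (Inl (ws ! i))) (wlists ! i) \<and>
           sorted_wrt (\<lambda>j k. (es ! j, es ! k) \<in> pref M (ws ! i)) (wlists ! i))) \<and>
     (\<exists>flists. length flists = length fs \<and> stores_lists s ''foff'' ''fadj'' flists \<and>
        (\<forall>i < length fs. represents es (edges_at M (Inr (fs ! i))) (flists ! i)))"

text \<open>
  Nothing is assumed about the order in which the oracle lists the elements of its answer, nor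
  about its answer to a list that does not represent a set of edges at the vertex in question.
\<close>

definition oracle_for ::
    "('w, 'f) market \<Rightarrow> 'f list \<Rightarrow> ('w \<times> 'f) list \<Rightarrow> (nat \<Rightarrow> nat list \<Rightarrow> nat list) \<Rightarrow> bool" where
  "oracle_for M fs es orc \<longleftrightarrow>
     (\<forall>i < length fs. \<forall>Z \<subseteq> edges_at M (Inr (fs ! i)). \<forall>zs. represents es Z zs \<longrightarrow>
        represents es (choice M (fs ! i) Z) (orc i zs))"

end

theory Submission
  imports Defs
begin

text \<open>
  The program is deferred acceptance with the vertices of \<open>W\<close> proposing, one edge at a time. Let
  \<open>A\<close> be the set of edges proposed so far and \<open>X \<subseteq> A\<close> the set of edges currently held. A vertex
  \<open>w\<close> that holds nothing proposes its best edge outside \<open>A\<close>, and the other end \<open>f\<close> of this edge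
  replaces its held edges by the choice from these and the new one. Since choice functions are path
  independent, \<open>f\<close> then holds its choice from all edges ever proposed to it.

  The heart of the argument is that an edge in \<open>A - X\<close>, one that has been rejected, belongs to no
  stable matching \<open>Y\<close>. It follows that an end \<open>w\<close> of a held edge \<open>x\<close> outside \<open>Y\<close> prefers \<open>x\<close> to
  whatever it has in \<open>Y\<close> (\<open>deferred_prefers\<close>): everything better than \<open>x\<close> has been rejected. As
  \<open>x\<close> does not block \<open>Y\<close>, the vertex \<open>f\<close> must decline \<open>x\<close>, so \<open>f\<close> chooses exactly its edges of
  \<open>Y\<close> from the union of its edges in \<open>X\<close> and \<open>Y\<close> (\<open>stable_choice_at\<close>). This has two
  consequences. First, an edge of \<open>Y\<close> at \<open>f\<close> cannot be rejected by the next proposal, which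
  preserves the invariant (\<open>deferred_propose\<close>). Second, at the end, when every \<open>w\<close> holds an edge
  or has proposed all its edges, \<open>X\<close> is stable and lies below every stable \<open>Y\<close>
  (\<open>deferred_X_min\<close>).

  For the time bound, every edge is proposed at most once, so \<open>|E|\<close> rounds suffice. A round may
  spend time \<open>O(|W|)\<close>: it finds a free vertex by scanning \<open>W\<close>, and, because each \<open>w\<close> holds at most
  one edge, it also finds the edges held at \<open>f\<close> by scanning \<open>W\<close>. The answer of the oracle is a
  subset of the query, hence also of size at most \<open>|W|\<close> (\<open>runs_round\<close>). All loops are counting
  loops with a bound fixed on entry, so one rule (\<open>runs_For\<close>) gives correctness and time together.
\<close>

section \<open>Deferred acceptance in a market with choice functions\<close>

lemma choice_rules:
  assumes "valid_market M" "f \<in> fside M"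
  shows choice_subset: "Z \<subseteq> edges_at M (Inr f) \<Longrightarrow> choice M f Z \<subseteq> Z"
    and choice_between: "Z \<subseteq> edges_at M (Inr f) \<Longrightarrow> Z' \<subseteq> Z \<Longrightarrow> choice M f Z \<subseteq> Z' \<Longrightarrow>
      choice M f Z' = choice M f Z"
    and choice_antimono: "Z \<subseteq> edges_at M (Inr f) \<Longrightarrow> Z' \<subseteq> Z \<Longrightarrow> e \<in> choice M f Z \<Longrightarrow> e \<in> Z' \<Longrightarrow>
      e \<in> choice M f Z'"
proof -
  note v = conjunct2[OF conjunct2[OF conjunct2[OF conjunct2[OF conjunct2[OF
    assms(1)[unfolded valid_market_def]]]]]]
  note * = bspec[OF conjunct1[OF v] assms(2)] bspec[OF conjunct2[OF v] assms(2)]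
  show "Z \<subseteq> edges_at M (Inr f) \<Longrightarrow> choice M f Z \<subseteq> Z"
    using *(1) by blast
  show "choice M f Z' = choice M f Z"
    if "Z \<subseteq> edges_at M (Inr f)" "Z' \<subseteq> Z" "choice M f Z \<subseteq> Z'"
    using *(2)[rule_format, of Z Z'] that by blast
  show "e \<in> choice M f Z'"
    if "Z \<subseteq> edges_at M (Inr f)" "Z' \<subseteq> Z" "e \<in> choice M f Z" "e \<in> Z'"
    using *(2)[rule_format, of Z Z'] that by blast
qed

text \<open>
  This is what makes it enough to remember the held edges instead of all proposals.
\<close>

lemma choice_path_independent:
  assumes "valid_market M" "f \<in> fside M" "Z \<subseteq> edges_at M (Inr f)" "e \<in> edges_at M (Inr f)"
  shows "choice M f (insert e (choice M f Z)) = choice M f (insert e Z)"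
proof (rule choice_between[OF assms(1,2)])
  show "insert e Z \<subseteq> edges_at M (Inr f)"
    using assms by blast
  then show "choice M f (insert e Z) \<subseteq> insert e (choice M f Z)"
    using choice_subset[OF assms(1,2)] choice_antimono[OF assms(1,2), of "insert e Z" Z] by blast
  show "insert e (choice M f Z) \<subseteq> insert e Z"
    using choice_subset[OF assms(1-3)] by blast
qed

text \<open>
  If every edge of \<open>Z\<close> outside the stable matching \<open>Y\<close> is wanted by its end in \<open>W\<close>, then \<open>f\<close> must
  decline each of them next to its edges of \<open>Y\<close>, for otherwise it would block \<open>Y\<close>. By
  substitutability they are then declined all at once.
\<close>

lemma stable_choice_at:
  assumes "valid_market M" "Y \<in> stable_matchings M" "f \<in> fside M"
    and Z: "Z \<subseteq> edges_at M (Inr f)"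
    and pref: "\<And>e y. e \<in> Z \<Longrightarrow> e \<notin> Y \<Longrightarrow> y \<in> Y \<Longrightarrow> fst y = fst e \<Longrightarrow> (e, y) \<in> pref M (fst e)"
  shows "choice M f (Y \<inter> edges_at M (Inr f) \<union> Z) = Y \<inter> edges_at M (Inr f)"
proof -
  let ?Y = "Y \<inter> edges_at M (Inr f)"
  have f: "Inr f \<in> verts M" and acc: "acceptable M Y" and nb: "\<And>e. \<not> blocking M Y e"
    using assms(2,3) by (auto simp: stable_matchings_def verts_def)
  have Y: "Y \<subseteq> edges M" "choice M f ?Y = ?Y"
    using acc bspec[OF conjunct2[OF acc[unfolded acceptable_def]] f]
    by (simp_all add: acceptable_def)
  have "e \<notin> choice M f (?Y \<union> Z)" if e: "e \<in> Z" "e \<notin> Y" for e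
  proof
    assume "e \<in> choice M f (?Y \<union> Z)"
    then have "e \<in> choice M f (?Y \<union> {e})"
      by (rule choice_antimono[OF assms(1,3), rotated 2]) (use Z e in auto)
    moreover have "e \<in> edges M" "snd e = f"
      using Z e by auto
    moreover have "e \<in> choice_at M (Inl (fst e)) (Y \<inter> edges_at M (Inl (fst e)) \<union> {e})"
      using pref[OF e] by simp
    ultimately show False
      using nb[of e] e unfolding blocking_def by simp
  qed
  moreover have "choice M f (?Y \<union> Z) \<subseteq> ?Y \<union> Z"
    using Z by (intro choice_subset[OF assms(1,3)]) auto
  ultimately have "choice M f (?Y \<union> Z) \<subseteq> ?Y"
    using Z by blast
  then have "choice M f ?Y = choice M f (?Y \<union> Z)"
    using Z by (intro choice_between[OF assms(1,3)]) auto
  then show ?thesis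
    using Y(2) by simp
qed

text \<open>
  The invariant of deferred acceptance, with \<open>A\<close> the proposed and \<open>X\<close> the held edges: proposals are
  made from the best edge downwards, only the latest proposal of a vertex can be held, and no
  rejected edge is in a stable matching.
\<close>

definition deferred :: "('w, 'f) market \<Rightarrow> ('w \<times> 'f) set \<Rightarrow> ('w \<times> 'f) set \<Rightarrow> bool" where
  "deferred M A X \<longleftrightarrow>
     A \<subseteq> edges M \<and> X \<subseteq> A \<and>
     (\<forall>a \<in> A. \<forall>e \<in> edges M. fst e = fst a \<longrightarrow> (e, a) \<in> pref M (fst a) \<longrightarrow> e \<in> A) \<and>
     (\<forall>x \<in> X. \<forall>a \<in> A. fst a = fst x \<longrightarrow> a \<noteq> x \<longrightarrow> (a, x) \<in> pref M (fst x)) \<and>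
     (\<forall>f \<in> fside M. X \<inter> edges_at M (Inr f) = choice M f (A \<inter> edges_at M (Inr f))) \<and>
     (\<forall>Y \<in> stable_matchings M. Y \<inter> A \<subseteq> X)"

lemma deferredD:
  assumes "deferred M A X"
  shows "A \<subseteq> edges M" "X \<subseteq> A"
    and "a \<in> A \<Longrightarrow> e \<in> edges M \<Longrightarrow> fst e = fst a \<Longrightarrow> (e, a) \<in> pref M (fst a) \<Longrightarrow> e \<in> A"
    and "x \<in> X \<Longrightarrow> a \<in> A \<Longrightarrow> fst a = fst x \<Longrightarrow> a \<noteq> x \<Longrightarrow> (a, x) \<in> pref M (fst x)"
    and "f \<in> fside M \<Longrightarrow> X \<inter> edges_at M (Inr f) = choice M f (A \<inter> edges_at M (Inr f))"
    and "Y \<in> stable_matchings M \<Longrightarrow> Y \<inter> A \<subseteq> X"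
proof -
  note * = assms[unfolded deferred_def]
  show "A \<subseteq> edges M" "X \<subseteq> A"
    using * by simp_all
  show "a \<in> A \<Longrightarrow> e \<in> edges M \<Longrightarrow> fst e = fst a \<Longrightarrow> (e, a) \<in> pref M (fst a) \<Longrightarrow> e \<in> A"
    using conjunct1[OF conjunct2[OF conjunct2[OF *]]] by blast
  show "x \<in> X \<Longrightarrow> a \<in> A \<Longrightarrow> fst a = fst x \<Longrightarrow> a \<noteq> x \<Longrightarrow> (a, x) \<in> pref M (fst x)"
    using conjunct1[OF conjunct2[OF conjunct2[OF conjunct2[OF *]]]] by blast
  show "f \<in> fside M \<Longrightarrow> X \<inter> edges_at M (Inr f) = choice M f (A \<inter> edges_at M (Inr f))"
    "Y \<in> stable_matchings M \<Longrightarrow> Y \<inter> A \<subseteq> X"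
    using * by simp_all
qed

lemma deferred_empty:
  assumes "valid_market M"
  shows "deferred M {} {}"
  using choice_subset[OF assms, of _ "{}"] by (auto simp: deferred_def)

lemma pref_order:
  assumes "valid_market M" "w \<in> wside M"
  shows "trans (pref M w)" "irrefl (pref M w)"
    "a \<in> edges_at M (Inl w) \<Longrightarrow> b \<in> edges_at M (Inl w) \<Longrightarrow> a \<noteq> b \<Longrightarrow>
       (a, b) \<in> pref M w \<or> (b, a) \<in> pref M w"
proof -
  note v = conjunct2[OF conjunct2[OF conjunct2[OF conjunct2[OF
    assms(1)[unfolded valid_market_def]]]]]
  note o = bspec[OF conjunct1[OF v] assms(2), unfolded strict_linear_order_on_def total_on_def]
  show "trans (pref M w)" "irrefl (pref M w)"
    using o by simp_all
  show "a \<in> edges_at M (Inl w) \<Longrightarrow> b \<in> edges_at M (Inl w) \<Longrightarrow> a \<noteq> b \<Longrightarrow>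
       (a, b) \<in> pref M w \<or> (b, a) \<in> pref M w"
    using o by blast
qed

lemma pref_not_sym:
  assumes "valid_market M" "w \<in> wside M" "(a, b) \<in> pref M w"
  shows "(b, a) \<notin> pref M w"
  using pref_order(1,2)[OF assms(1,2)] assms(3) by (meson irreflD transD)

lemma edge_ends:
  assumes "valid_market M" "e \<in> edges M"
  shows "fst e \<in> wside M" "snd e \<in> fside M"
proof -
  have "edges M \<subseteq> wside M \<times> fside M"
    using assms(1) unfolding valid_market_def by (elim conjE)
  then show "fst e \<in> wside M" "snd e \<in> fside M"
    using assms(2) by auto
qed

text \<open>
  An edge \<open>y\<close> that the common end prefers to the held edge \<open>x\<close> was proposed before \<open>x\<close> and
  rejected, so it cannot be in \<open>Y\<close>.
\<close>

lemma deferred_prefers: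
  assumes vm: "valid_market M" and d: "deferred M A X" and Y: "Y \<in> stable_matchings M"
    and x: "x \<in> X" "x \<notin> Y" and y: "y \<in> Y" "fst y = fst x"
  shows "(x, y) \<in> pref M (fst x)"
proof (rule ccontr)
  assume n: "(x, y) \<notin> pref M (fst x)"
  have xy: "x \<in> A" "x \<in> edges M" "y \<in> edges M" "x \<noteq> y"
    using deferredD(1,2)[OF d] x y Y by (auto simp: stable_matchings_def acceptable_def)
  note w = edge_ends(1)[OF vm xy(2)]
  have yx: "(y, x) \<in> pref M (fst x)"
    using pref_order(3)[OF vm w, of x y] n xy y(2) by simp
  then have "y \<in> A"
    using deferredD(3)[OF d xy(1,3) y(2)] by simp
  then have "y \<in> X"
    using deferredD(6)[OF d Y] y(1) by blast
  then have "(x, y) \<in> pref M (fst x)"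
    using deferredD(4)[OF d, of y x] xy y(2) by simp
  then show False
    using n by simp
qed

text \<open>
  An edge that its end in \<open>W\<close> would like to have has been proposed and rejected. The end in \<open>F\<close>
  declined it when choosing from a larger set than now, and still does so because the choice from
  that larger set is what it holds.
\<close>

lemma deferred_X_min:
  assumes vm: "valid_market M" and d: "deferred M A X"
    and fin: "\<And>e. e \<in> edges M \<Longrightarrow> e \<notin> A \<Longrightarrow> \<exists>x \<in> X. fst x = fst e"
  shows "is_X_min M X"
proof -
  note AX = deferredD(1,2)[OF d] and up = deferredD(3)[OF d] and low = deferredD(4)[OF d]
    and ch = deferredD(5)[OF d]
  have one: "x = y" if "x \<in> X" "y \<in> X" "fst x = fst y" for x y
  proof (rule ccontr)
    assume "x \<noteq> y"
    then have "(x, y) \<in> pref M (fst x)" "(y, x) \<in> pref M (fst x)"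
      using low[of x y] low[of y x] that AX(2) by auto
    moreover have "fst x \<in> wside M"
      using edge_ends[OF vm] that AX by blast
    ultimately show False
      using pref_not_sym[OF vm] by blast
  qed
  have acc: "acceptable M X"
    unfolding acceptable_def
  proof (intro conjI ballI)
    show "X \<subseteq> edges M"
      using AX by blast
    fix v assume "v \<in> verts M"
    then show "choice_at M v (X \<inter> edges_at M v) = X \<inter> edges_at M v"
    proof (cases v)
      case (Inl w)
      then show ?thesis
        using one by auto
    next
      case (Inr f)
      with \<open>v \<in> verts M\<close> have f: "f \<in> fside M"
        by (auto simp: verts_def)
      have "choice M f (X \<inter> edges_at M (Inr f)) = choice M f (A \<inter> edges_at M (Inr f))"
        using AX(2) ch[OF f] by (intro choice_between[OF vm f]) auto
      then show ?thesis
        using Inr ch[OF f] by simp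
    qed
  qed
  have "\<not> blocking M X e" for e
  proof
    assume b: "blocking M X e"
    then have e: "e \<in> edges M" "e \<notin> X" and f: "snd e \<in> fside M"
      using edge_ends[OF vm] by (auto simp: blocking_def)
    let ?E = "edges_at M (Inr (snd e))"
    have "e \<in> A"
    proof (rule ccontr)
      assume "e \<notin> A"
      then obtain x where x: "x \<in> X" "fst x = fst e"
        using fin e by blast
      then have "(e, x) \<in> pref M (fst x)"
        using b AX e by (auto simp: blocking_def)
      then show False
        using up[of x e] x AX e \<open>e \<notin> A\<close> by auto
    qed
    then have "choice M (snd e) (X \<inter> ?E \<union> {e}) = choice M (snd e) (A \<inter> ?E)"
      using AX e ch[OF f] by (intro choice_between[OF vm f]) auto
    then have "choice M (snd e) (X \<inter> ?E \<union> {e}) = X \<inter> ?E"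
      using ch[OF f] by simp
    then show False
      using b e by (auto simp: blocking_def)
  qed
  then have st: "X \<in> stable_matchings M"
    using acc by (auto simp: stable_matchings_def)
  have "prec_F M X Y" if Y: "Y \<in> stable_matchings M" "Y \<noteq> X" for Y
    unfolding prec_F_def weakly_prefers_def
  proof (intro conjI ballI)
    show "acceptable M Y"
      using Y by (auto simp: stable_matchings_def)
    fix f assume f: "f \<in> fside M"
    show "choice_at M (Inr f) (Y \<inter> edges_at M (Inr f) \<union> X \<inter> edges_at M (Inr f)) =
      Y \<inter> edges_at M (Inr f)"
      using stable_choice_at[OF vm Y(1) f, of "X \<inter> edges_at M (Inr f)"]
        deferred_prefers[OF vm d Y(1)] by auto
  qed (use acc Y in auto)
  then show ?thesis
    using st by (auto simp: is_X_min_def)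
qed

text \<open>
  The only delicate part of the invariant is that a newly rejected edge \<open>r\<close> at \<open>f\<close> is in no stable
  matching \<open>Y\<close>. If it were, \<open>f\<close> would choose \<open>r\<close> from the union of its edges of \<open>Y\<close> and the newly
  held ones, hence also from the newly held ones with \<open>r\<close> added; but this set lies between the
  proposals to \<open>f\<close> and the choice from them, which omits \<open>r\<close>.
\<close>

lemma deferred_propose:
  assumes vm: "valid_market M" and d: "deferred M A X"
    and e: "e \<in> edges M" "e \<notin> A"
    and free: "\<And>x. x \<in> X \<Longrightarrow> fst x \<noteq> fst e"
    and best: "\<And>e'. e' \<in> edges M \<Longrightarrow> fst e' = fst e \<Longrightarrow> e' \<notin> A \<Longrightarrow> e' \<noteq> e \<Longrightarrow>
      (e, e') \<in> pref M (fst e)"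
  defines "f \<equiv> snd e"
  shows "deferred M (insert e A)
    (X - edges_at M (Inr f) \<union> choice M f (insert e (X \<inter> edges_at M (Inr f))))"
    (is "deferred M _ ?X'")
proof -
  note AX = deferredD(1,2)[OF d] and up = deferredD(3)[OF d] and low = deferredD(4)[OF d]
    and ch = deferredD(5)[OF d] and st = deferredD(6)[OF d]
  have w: "fst e \<in> wside M" and f: "f \<in> fside M"
    using edge_ends[OF vm e(1)] by (auto simp: f_def)
  let ?E = "edges_at M (Inr f)"
  have eE: "e \<in> ?E"
    using e by (simp add: f_def)
  have AE: "insert e (A \<inter> ?E) \<subseteq> ?E" "insert e A \<inter> ?E = insert e (A \<inter> ?E)"
    using eE by auto
  have C: "choice M f (insert e (X \<inter> ?E)) = choice M f (insert e A \<inter> ?E)"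
    using choice_path_independent[OF vm f _ eE, of "A \<inter> ?E"] ch[OF f] AE(2) by simp
  have Csub: "choice M f (insert e (X \<inter> ?E)) \<subseteq> insert e (X \<inter> ?E)"
    using eE by (intro choice_subset[OF vm f]) auto
  then have X': "?X' \<subseteq> insert e X" "?X' \<inter> ?E = choice M f (insert e (X \<inter> ?E))"
    using eE by auto
  have up': "e' \<in> insert e A" if "a \<in> insert e A" "e' \<in> edges M" "fst e' = fst a"
    "(e', a) \<in> pref M (fst a)" for a e'
    using up[of a e'] best[of e'] pref_not_sym[OF vm w, of e e'] that by auto
  have low': "(a, x) \<in> pref M (fst x)" if "x \<in> insert e X" "a \<in> insert e A" "fst a = fst x" "a \<noteq> x"
    for a x
  proof (cases "x = e")
    case True
    then have "a \<in> A"
      using that by auto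
    then show ?thesis
      using True that pref_order(3)[OF vm w, of a e] up[of a e] e AX by auto
  next
    case False
    then have x: "x \<in> X" "fst x \<noteq> fst e"
      using that free by auto
    then have "a \<in> A"
      using that by auto
    then show ?thesis
      using low[of x a] x that by simp
  qed
  have ch': "?X' \<inter> edges_at M (Inr g) = choice M g (insert e A \<inter> edges_at M (Inr g))"
    if g: "g \<in> fside M" for g
  proof (cases "g = f")
    case True
    then show ?thesis
      using X'(2) C by simp
  next
    case False
    then have "insert e A \<inter> edges_at M (Inr g) = A \<inter> edges_at M (Inr g)"
      "?X' \<inter> edges_at M (Inr g) = X \<inter> edges_at M (Inr g)"
      using eE Csub by auto
    then show ?thesis
      using ch[OF g] by simp
  qed
  have st': "r \<in> ?X'" if Y: "Y \<in> stable_matchings M" and r: "r \<in> Y" "r \<in> insert e A" for Y r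
  proof (rule ccontr)
    assume nr: "r \<notin> ?X'"
    have YE: "Y \<subseteq> edges M"
      using Y by (auto simp: stable_matchings_def acceptable_def)
    have "r \<in> insert e X"
      using st[OF Y] r by blast
    then have rE: "r \<in> ?E"
      using nr eE by auto
    \<comment> \<open>For the new edge \<open>e\<close> itself: an edge of \<open>Y\<close> at the proposing vertex would be unproposed, as
      that vertex holds nothing, so it comes after \<open>e\<close>.\<close>
    have "(x, y) \<in> pref M (fst x)"
      if x: "x \<in> ?X' \<inter> ?E" "x \<notin> Y" and y: "y \<in> Y" "fst y = fst x" for x y
    proof (cases "x \<in> X")
      case True
      then show ?thesis
        using deferred_prefers[OF vm d Y] x y by blast
    next
      case False
      then have "x = e"
        using x X'(1) by blast
      moreover from this have "y \<notin> A"
        using st[OF Y] y free[of y] by auto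
      ultimately show ?thesis
        using best[of y] x y YE by auto
    qed
    then have "choice M f (Y \<inter> ?E \<union> ?X' \<inter> ?E) = Y \<inter> ?E"
      by (intro stable_choice_at[OF vm Y f]) auto
    then have "r \<in> choice M f (insert r (?X' \<inter> ?E))"
      using r rE choice_antimono[OF vm f, of "Y \<inter> ?E \<union> ?X' \<inter> ?E" "insert r (?X' \<inter> ?E)" r] by blast
    also have "\<dots> = choice M f (insert e A \<inter> ?E)"
      using r rE AX X' C by (intro choice_between[OF vm f]) auto
    also have "\<dots> \<subseteq> ?X'"
      using C by auto
    finally show False
      using nr by simp
  qed
  show ?thesis
    unfolding deferred_def
  proof (intro conjI ballI impI subsetI)
    show "\<And>a. a \<in> insert e A \<Longrightarrow> a \<in> edges M"
      using e AX by blast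
    show "\<And>x. x \<in> ?X' \<Longrightarrow> x \<in> insert e A"
      using X'(1) AX by blast
    show "\<And>x a. x \<in> ?X' \<Longrightarrow> a \<in> insert e A \<Longrightarrow> fst a = fst x \<Longrightarrow> a \<noteq> x \<Longrightarrow> (a, x) \<in> pref M (fst x)"
      using low' X'(1) by blast
  qed (use up' ch' st' in auto)
qed

section \<open>Timed program logic\<close>

text \<open>
  Arrays that a program never writes to are unchanged by it. Building this frame property into the
  rules below keeps loop invariants free of statements about the input.
\<close>

fun mods :: "com \<Rightarrow> vname set" where
  "mods Skip = {}"
| "mods (Assign x i a) = {x}"
| "mods (Seq p q) = mods p \<union> mods q"
| "mods (If b p q) = mods p \<union> mods q"
| "mods (While b p) = mods p"
| "mods (Ask y a x) = {y}"

lemma exec_frame: "exec orc p s t s' \<Longrightarrow> x \<notin> mods p \<Longrightarrow> s' x = s x"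
  by (induction rule: exec.induct) auto

definition runs :: "(nat \<Rightarrow> nat list \<Rightarrow> nat list) \<Rightarrow> com \<Rightarrow> state \<Rightarrow> nat \<Rightarrow> (state \<Rightarrow> bool) \<Rightarrow> bool" where
  "runs orc p s T Q \<longleftrightarrow> (\<exists>t s'. exec orc p s t s' \<and> t \<le> T \<and> Q s')"

lemma runs_frame:
  assumes "runs orc p s T Q"
  shows "runs orc p s T (\<lambda>s'. Q s' \<and> (\<forall>x. x \<notin> mods p \<longrightarrow> s' x = s x))"
  using assms exec_frame unfolding runs_def by blast

lemma runs_mono:
  assumes "runs orc p s T Q" "T \<le> T'" "\<And>s'. Q s' \<Longrightarrow> (\<And>x. x \<notin> mods p \<Longrightarrow> s' x = s x) \<Longrightarrow> Q' s'"
  shows "runs orc p s T' Q'"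
  using runs_frame[OF assms(1)] assms(2,3) unfolding runs_def by (meson le_trans)

lemma runs_Seq:
  assumes "runs orc p s T Q"
    and "\<And>s'. Q s' \<Longrightarrow> (\<And>x. x \<notin> mods p \<Longrightarrow> s' x = s x) \<Longrightarrow> runs orc q s' U R"
  shows "runs orc (Seq p q) s (T + U) R"
  using runs_frame[OF assms(1)] assms(2) unfolding runs_def by (meson exec.Seq add_mono)

lemma runs_If:
  assumes "bval b s \<Longrightarrow> runs orc p s T Q" "\<not> bval b s \<Longrightarrow> runs orc q s T Q"
  shows "runs orc (If b p q) s (bcost b + T + 1) Q"
  using assms unfolding runs_def
  by (cases "bval b s") (fastforce intro: exec.IfTrue exec.IfFalse)+

text \<open>
  Loop-free programs are handled by symbolic evaluation. At a loop, the value of \<open>outcome\<close> is a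
  dummy.
\<close>

fun outcome :: "(nat \<Rightarrow> nat list \<Rightarrow> nat list) \<Rightarrow> com \<Rightarrow> state \<Rightarrow> state" where
  "outcome orc Skip s = s"
| "outcome orc (Assign x i a) s = s(x := (s x)(aval i s := aval a s))"
| "outcome orc (Seq p q) s = outcome orc q (outcome orc p s)"
| "outcome orc (If b p q) s = (if bval b s then outcome orc p s else outcome orc q s)"
| "outcome orc (While b p) s = s"
| "outcome orc (Ask y a x) s = s(y := write_list (orc (aval a s) (read_list (s x))) (s y))"

fun loop_free :: "com \<Rightarrow> bool" where
  "loop_free (Seq p q) \<longleftrightarrow> loop_free p \<and> loop_free q"
| "loop_free (If b p q) \<longleftrightarrow> loop_free p \<and> loop_free q"
| "loop_free (While b p) \<longleftrightarrow> False"
| "loop_free _ \<longleftrightarrow> True"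

text \<open>
  An upper bound, not the exact time: both branches of a conditional are charged.
\<close>

fun ticks :: "com \<Rightarrow> nat" where
  "ticks (Assign x i a) = acost i + acost a + 1"
| "ticks (Seq p q) = ticks p + ticks q"
| "ticks (If b p q) = bcost b + (ticks p + ticks q) + 1"
| "ticks (Ask y a x) = acost a + 1"
| "ticks _ = 1"

lemma runs_loop_free:
  assumes "loop_free p" "Q (outcome orc p s)"
  shows "runs orc p s (ticks p) Q"
proof -
  have "\<exists>t \<le> ticks p. exec orc p s t (outcome orc p s)"
    using assms(1)
  proof (induction p arbitrary: s)
    case (Seq p q)
    then show ?case
      by (auto intro!: exec.Seq) (meson exec.Seq add_mono)
  next
    case (If b p q)
    obtain t u where tu: "t \<le> ticks p" "exec orc p s t (outcome orc p s)"
      "u \<le> ticks q" "exec orc q s u (outcome orc q s)"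
      using If by (metis loop_free.simps(2))
    show ?case
    proof (cases "bval b s")
      case True
      then have "exec orc (If b p q) s (bcost b + t + 1) (outcome orc (If b p q) s)"
        using exec.IfTrue tu by simp
      then show ?thesis
        using tu by (intro exI[of _ "bcost b + t + 1"]) simp
    next
      case False
      then have "exec orc (If b p q) s (bcost b + u + 1) (outcome orc (If b p q) s)"
        using exec.IfFalse tu by simp
      then show ?thesis
        using tu by (intro exI[of _ "bcost b + u + 1"]) simp
    qed
  next
    case (Assign x i a)
    show ?case
      by (intro exI[of _ "acost i + acost a + 1"] conjI) (simp, simp only: outcome.simps exec.Assign)
  next
    case (Ask y a x)
    show ?case
      by (intro exI[of _ "acost a + 1"] conjI) (simp, simp only: outcome.simps exec.Ask)
  next
    case Skip
    show ?case
      by (intro exI[of _ 1] conjI) (simp, simp only: outcome.simps exec.Skip)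
  qed simp
  then show ?thesis
    using assms(2) unfolding runs_def by blast
qed

definition For :: "vname \<Rightarrow> vname \<Rightarrow> com \<Rightarrow> com" where
  "For i b p = Seq (Assign i (Const 0) (Const 0))
     (While (Less (Cell i (Const 0)) (Cell b (Const 0)))
       (Seq p (Assign i (Const 0) (Plus (Cell i (Const 0)) (Const 1)))))"

lemma mods_For [simp]: "mods (For i b p) = insert i (mods p)"
  by (auto simp: For_def)

text \<open>
  In each iteration, \<open>12\<close> units pay for the test (\<open>5 + 1\<close>) and for the increment (\<open>6\<close>); the
  remaining \<open>9\<close> units pay for the initial assignment (\<open>3\<close>) and for the last test (\<open>6\<close>).
\<close>

lemma runs_For:
  assumes vars: "i \<noteq> b" "i \<notin> mods p" "b \<notin> mods p" and N: "s b 0 = N"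
    and indep: "\<And>k s g. I k (s(i := g)) \<longleftrightarrow> I k s"
    and init: "I 0 s"
    and step: "\<And>k s'. k < N \<Longrightarrow> s' i 0 = k \<Longrightarrow> (\<And>x. x \<notin> insert i (mods p) \<Longrightarrow> s' x = s x) \<Longrightarrow>
      I k s' \<Longrightarrow> runs orc p s' T (I (Suc k))"
  shows "runs orc (For i b p) s (N * (T + 12) + 9) (I N)"
proof -
  let ?b = "Less (Cell i (Const 0)) (Cell b (Const 0))"
  let ?inc = "Assign i (Const 0) (Plus (Cell i (Const 0)) (Const 1))"
  let ?w = "While ?b (Seq p ?inc)"
  have loop: "runs orc ?w s' ((N - k) * (T + 12) + 6) (I N)"
    if "k \<le> N" "s' i 0 = k" "\<And>x. x \<notin> insert i (mods p) \<Longrightarrow> s' x = s x" "I k s'" for k s'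
    using that
  proof (induction "N - k" arbitrary: k s')
    case 0
    then have "\<not> bval ?b s'" "k = N"
      using N vars by auto
    then show ?case
      using exec.WhileFalse[of ?b s' orc "Seq p ?inc"] 0 unfolding runs_def by fastforce
  next
    case (Suc n)
    then have k: "k < N" and b: "bval ?b s'"
      using N vars by auto
    obtain t u where u: "exec orc p s' t u" "t \<le> T" "I (Suc k) u"
      using step[OF k Suc.prems(2-4)] unfolding runs_def by blast
    have ui: "u i = s' i"
      using exec_frame[OF u(1)] vars by blast
    define v where "v = u(i := (u i)(0 := Suc k))"
    have v: "exec orc (Seq p ?inc) s' (t + 6) v"
      using exec.Seq[OF u(1) exec.Assign[of orc i "Const 0" "Plus (Cell i (Const 0)) (Const 1)" u]]
        ui Suc.prems(2) by (simp add: v_def eval_nat_numeral)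
    have "runs orc ?w v ((N - Suc k) * (T + 12) + 6) (I N)"
    proof (rule Suc.hyps(1))
      show "v x = s x" if "x \<notin> insert i (mods p)" for x
        using Suc.prems(3)[of x] exec_frame[OF u(1), of x] that by (auto simp: v_def)
    qed (use Suc k u indep in \<open>auto simp: v_def\<close>)
    then obtain t' s'' where w: "exec orc ?w v t' s''" "t' \<le> (N - Suc k) * (T + 12) + 6" "I N s''"
      unfolding runs_def by blast
    have "N - k = Suc (N - Suc k)"
      using k by simp
    then have "bcost ?b + (t + 6) + t' + 1 \<le> (N - k) * (T + 12) + 6"
      using w(2) u(2) by simp
    then show ?case
      using exec.WhileTrue[OF b v w(1)] w(3) unfolding runs_def by blast
  qed
  have "runs orc ?w (s(i := (s i)(0 := 0))) (N * (T + 12) + 6) (I N)"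
    using loop[of 0 "s(i := (s i)(0 := 0))"] init indep by simp
  moreover have "exec orc (Assign i (Const 0) (Const 0)) s 3 (s(i := (s i)(0 := 0)))"
    using exec.Assign[of orc i "Const 0" "Const 0" s] by (simp add: eval_nat_numeral)
  ultimately show ?thesis
    unfolding For_def runs_def by (fastforce dest: exec.Seq)
qed

section \<open>The program\<close>

text \<open>
  The cell \<open>ptr[w]\<close> holds the position in \<open>wadj\<close> of the next proposal of \<open>w\<close>. The cell
  \<open>mate[w]\<close> holds \<open>0\<close> if \<open>w\<close> is free, and \<open>e + 1\<close> if it holds the edge number \<open>e\<close>.
\<close>

abbreviation Var :: "vname \<Rightarrow> aexp" where
  "Var x \<equiv> Cell x (Const 0)"

text \<open>
  The value \<open>u = nW\<close> signals that no vertex can propose.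
\<close>

definition find_free :: com where
  "find_free = Seq (Assign ''u'' (Const 0) (Var ''nW''))
     (For ''w'' ''nW''
       (If (And (Equal (Cell ''mate'' (Var ''w'')) (Const 0))
              (Less (Cell ''ptr'' (Var ''w'')) (Cell ''woff'' (Plus (Var ''w'') (Const 1)))))
         (Assign ''u'' (Const 0) (Var ''w''))
         Skip))"

definition propose :: com where
  "propose = Seq (Assign ''e'' (Const 0) (Cell ''wadj'' (Cell ''ptr'' (Var ''u''))))
     (Seq (Assign ''ptr'' (Var ''u'') (Plus (Cell ''ptr'' (Var ''u'')) (Const 1)))
     (Seq (Assign ''mate'' (Var ''u'') (Plus (Var ''e'') (Const 1)))
          (Assign ''f'' (Const 0) (Cell ''fend'' (Var ''e'')))))"

text \<open>
  Moves the held edges that satisfy \<open>b\<close> from \<open>mate\<close> to the list \<open>out\<close>. It serves both to form the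
  query to the oracle, after which the answer is put back, and to write the final output.
\<close>

definition collect :: "bexp \<Rightarrow> com" where
  "collect b = Seq (Assign ''out'' (Const 0) (Const 0))
     (For ''w'' ''nW''
       (If (And (Less (Const 0) (Cell ''mate'' (Var ''w''))) b)
         (Seq (Assign ''out'' (Const 0) (Plus (Var ''out'') (Const 1)))
         (Seq (Assign ''out'' (Var ''out'') (Minus (Cell ''mate'' (Var ''w'')) (Const 1)))
              (Assign ''mate'' (Var ''w'') (Const 0))))
         Skip))"

definition refill :: com where
  "refill = For ''k'' ''ans''
     (Assign ''mate'' (Cell ''wend'' (Cell ''ans'' (Plus (Var ''k'') (Const 1))))
       (Plus (Cell ''ans'' (Plus (Var ''k'') (Const 1))) (Const 1)))"

definition at_f :: bexp where
  "at_f = Equal (Cell ''fend'' (Minus (Cell ''mate'' (Var ''w'')) (Const 1))) (Var ''f'')"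

definition round :: com where
  "round = Seq find_free
     (If (Less (Var ''u'') (Var ''nW''))
       (Seq propose (Seq (collect at_f) (Seq (Ask ''ans'' (Var ''f'') ''out'') refill)))
       Skip)"

definition everything :: bexp where
  "everything = Equal (Const 0) (Const 0)"

text \<open>
  The round is repeated \<open>nE\<close> times whether or not a free vertex is left: a round without a free
  vertex changes neither \<open>ptr\<close> nor \<open>mate\<close>.
\<close>

definition deferred_acceptance :: com where
  "deferred_acceptance = Seq
     (For ''w'' ''nW'' (Seq (Assign ''ptr'' (Var ''w'') (Cell ''woff'' (Var ''w'')))
                            (Assign ''mate'' (Var ''w'') (Const 0))))
     (Seq (For ''r'' ''nE'' round) (collect everything))"

lemma mods_find_free [simp]: "mods find_free = {''u'', ''w''}"
  and mods_propose [simp]: "mods propose = {''e'', ''ptr'', ''mate'', ''f''}"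
  and mods_collect [simp]: "mods (collect b) = {''out'', ''mate'', ''w''}"
  and mods_refill [simp]: "mods refill = {''mate'', ''k''}"
  by (auto simp: find_free_def propose_def collect_def refill_def)

lemma mods_round [simp]:
  "mods round = {''u'', ''w'', ''e'', ''ptr'', ''mate'', ''f'', ''out'', ''ans'', ''k''}"
  by (auto simp: round_def)

section \<open>Correctness and running time\<close>

text \<open>
  What the program uses about its input, freed from the lists of vertices and of incident edges.
\<close>

locale numbered_market =
  fixes M :: "('w, 'f) market" and es :: "('w \<times> 'f) list"
    and nW :: nat and wend fend woff wadj :: "nat \<Rightarrow> nat"
    and orc :: "nat \<Rightarrow> nat list \<Rightarrow> nat list"
  assumes valid: "valid_market M"
    and es: "distinct es" "set es = edges M"
    and wend_less: "j < length es \<Longrightarrow> wend j < nW"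
    and wend_iff: "i < length es \<Longrightarrow> j < length es \<Longrightarrow> fst (es ! i) = fst (es ! j) \<longleftrightarrow> wend i = wend j"
    and fend_iff: "i < length es \<Longrightarrow> j < length es \<Longrightarrow> snd (es ! i) = snd (es ! j) \<longleftrightarrow> fend i = fend j"
    and woff_mono: "w < nW \<Longrightarrow> woff w \<le> woff (Suc w)"
    and wadj_edge: "w < nW \<Longrightarrow> woff w \<le> k \<Longrightarrow> k < woff (Suc w) \<Longrightarrow> wadj k < length es \<and> wend (wadj k) = w"
    and wadj_all: "j < length es \<Longrightarrow> \<exists>k. woff (wend j) \<le> k \<and> k < woff (Suc (wend j)) \<and> wadj k = j"
    and wadj_sorted: "w < nW \<Longrightarrow> woff w \<le> k \<Longrightarrow> k < l \<Longrightarrow> l < woff (Suc w) \<Longrightarrow>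
      (es ! wadj k, es ! wadj l) \<in> pref M (fst (es ! wadj k))"
    and orc_choice: "j < length es \<Longrightarrow> Z \<subseteq> edges_at M (Inr (snd (es ! j))) \<Longrightarrow> represents es Z zs \<Longrightarrow>
      represents es (choice M (snd (es ! j)) Z) (orc (fend j) zs)"
begin

abbreviation "nE \<equiv> length es"

definition input :: "state \<Rightarrow> bool" where
  "input s \<longleftrightarrow> s ''nW'' 0 = nW \<and> s ''nE'' 0 = nE \<and> s ''wend'' = wend \<and> s ''fend'' = fend \<and>
     s ''woff'' = woff \<and> s ''wadj'' = wadj"

text \<open>
  Stated from both sides: each edge of \<open>X\<close> is recorded at its end in \<open>W\<close>, and each record is
  an edge at the vertex where it is found. So \<open>X\<close> has at most one edge at each vertex of \<open>W\<close>.
\<close>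

definition mates :: "(nat \<Rightarrow> nat) \<Rightarrow> ('w \<times> 'f) set \<Rightarrow> bool" where
  "mates m X \<longleftrightarrow> X \<subseteq> edges M \<and> (\<forall>e < nE. es ! e \<in> X \<longleftrightarrow> m (wend e) = Suc e) \<and>
     (\<forall>w < nW. \<forall>e. m w = Suc e \<longrightarrow> e < nE \<and> wend e = w)"

definition proposed :: "(nat \<Rightarrow> nat) \<Rightarrow> ('w \<times> 'f) set \<Rightarrow> bool" where
  "proposed p A \<longleftrightarrow> A \<subseteq> edges M \<and> (\<forall>w < nW. woff w \<le> p w \<and> p w \<le> woff (Suc w) \<and>
     (\<forall>k. woff w \<le> k \<longrightarrow> k < woff (Suc w) \<longrightarrow> (es ! wadj k \<in> A \<longleftrightarrow> k < p w)))"

lemma nth_eq: "i < nE \<Longrightarrow> j < nE \<Longrightarrow> es ! i = es ! j \<longleftrightarrow> i = j"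
  using es(1) by (simp add: nth_eq_iff_index_eq)

lemma edge_number:
  assumes "x \<in> edges M"
  obtains e where "e < nE" "x = es ! e"
  using assms es(2) by (metis in_set_conv_nth)

lemma nth_edge: "e < nE \<Longrightarrow> es ! e \<in> edges M"
  using es(2) nth_mem by blast

lemma mates_D:
  assumes "mates m X" "w < nW" "m w = Suc e"
  shows "e < nE" "wend e = w" "es ! e \<in> X"
  using assms by (auto simp: mates_def)

lemma mates_nth:
  assumes "mates m X" "e < nE"
  shows "es ! e \<in> X \<longleftrightarrow> m (wend e) = Suc e"
  using assms by (auto simp: mates_def)

lemma mates_edge:
  assumes "mates m X" "x \<in> X"
  obtains e where "e < nE" "x = es ! e" "m (wend e) = Suc e"
proof -
  from assms have "x \<in> edges M"
    by (auto simp: mates_def)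
  then obtain e where "e < nE" "x = es ! e"
    by (rule edge_number)
  with assms that show ?thesis
    by (auto simp: mates_nth)
qed

lemma mates_inj:
  assumes "mates m X"
  shows "inj_on fst X"
proof (rule inj_onI)
  fix x y assume "x \<in> X" "y \<in> X" "fst x = fst y"
  then obtain e e' where "e < nE" "x = es ! e" "m (wend e) = Suc e"
    "e' < nE" "y = es ! e'" "m (wend e') = Suc e'" "wend e = wend e'"
    using mates_edge[OF assms, of x] mates_edge[OF assms, of y] wend_iff by metis
  then show "x = y"
    by (metis nat.inject)
qed

lemma mates_insert:
  assumes m: "mates m X" and e: "e < nE" and free: "\<And>x. x \<in> X \<Longrightarrow> fst x \<noteq> fst (es ! e)"
  shows "mates (m(wend e := Suc e)) (insert (es ! e) X)"
proof -
  have "es ! e' \<notin> X" if "e' < nE" "wend e' = wend e" for e'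
    using free[of "es ! e'"] that e wend_iff by blast
  then show ?thesis
    using m e nth_edge nth_eq by (auto simp: mates_def)
qed

lemma mates_remove:
  assumes m: "mates m X" and "w < nW" "m w = Suc e"
  shows "mates (m(w := 0)) (X - {es ! e})"
  using assms mates_D[OF assms] nth_eq by (auto simp: mates_def)

lemma mates_free:
  assumes m: "mates m X" and "w < nW" "m w = 0" and e: "e < nE" "wend e = w"
    and x: "x \<in> X"
  shows "fst x \<noteq> fst (es ! e)"
  using mates_edge[OF m x] assms wend_iff by (metis nat.distinct(1))

lemma represents_append:
  assumes "represents es Z zs" "e < nE" "es ! e \<notin> Z"
  shows "represents es (insert (es ! e) Z) (zs @ [e])"
  using assms by (auto simp: represents_def)

lemma read_list_append:
  assumes "g' 0 = Suc (g 0)" "g' (Suc (g 0)) = v" "\<And>i. 0 < i \<Longrightarrow> i \<le> g 0 \<Longrightarrow> g' i = g i"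
  shows "read_list g' = read_list g @ [v]"
  using assms by (auto simp: read_list_def)

lemma read_write_list: "read_list (write_list xs g) = xs"
  by (rule nth_equalityI) (auto simp: read_list_def write_list_def simp del: upt_Suc)

lemma runs_find_free:
  assumes s: "input s"
  shows "runs orc find_free s (100 * Suc nW) (\<lambda>s'.
    (s' ''u'' 0 = nW \<and> (\<forall>w < nW. s ''mate'' w = 0 \<longrightarrow> \<not> s ''ptr'' w < woff (Suc w))) \<or>
    (s' ''u'' 0 < nW \<and> s ''mate'' (s' ''u'' 0) = 0 \<and>
      s ''ptr'' (s' ''u'' 0) < woff (Suc (s' ''u'' 0))))"
proof -
  let ?I = "\<lambda>k s'.
    (s' ''u'' 0 = nW \<and> (\<forall>w < k. s ''mate'' w = 0 \<longrightarrow> \<not> s ''ptr'' w < woff (Suc w))) \<or>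
    (s' ''u'' 0 < nW \<and> s ''mate'' (s' ''u'' 0) = 0 \<and>
      s ''ptr'' (s' ''u'' 0) < woff (Suc (s' ''u'' 0)))"
  let ?init = "Assign ''u'' (Const 0) (Var ''nW'')"
  let ?body = "If (And (Equal (Cell ''mate'' (Var ''w'')) (Const 0))
              (Less (Cell ''ptr'' (Var ''w'')) (Cell ''woff'' (Plus (Var ''w'') (Const 1)))))
         (Assign ''u'' (Const 0) (Var ''w''))
         Skip"
  have init: "runs orc ?init s (ticks ?init) (\<lambda>s'. s' ''u'' 0 = nW)"
    using s by (intro runs_loop_free) (simp_all add: input_def)
  have loop: "runs orc (For ''w'' ''nW'' ?body) s1 (nW * (ticks ?body + 12) + 9) (?I nW)"
    if "s1 ''u'' 0 = nW" and fr: "\<And>x. x \<notin> mods ?init \<Longrightarrow> s1 x = s x" for s1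
  proof (rule runs_For[where I = ?I])
    fix k s' assume "k < nW" "s' ''w'' 0 = k" "?I k s'"
      and "\<And>x. x \<notin> insert ''w'' (mods ?body) \<Longrightarrow> s' x = s1 x"
    then show "runs orc ?body s' (ticks ?body) (?I (Suc k))"
      using s fr by (intro runs_loop_free) (auto simp: input_def less_Suc_eq)
  qed (use s that in \<open>simp_all add: input_def\<close>)
  show ?thesis
    unfolding find_free_def
    by (rule runs_mono[OF runs_Seq[OF init loop]]) simp_all
qed

text \<open>
  The test \<open>b\<close> is only ever evaluated in states that differ from the initial one in the arrays which
  the loop writes, hence the form of the assumption on \<open>R\<close>.
\<close>

lemma runs_collect:
  assumes s: "input s" and m: "mates (s ''mate'') X"
    and R: "\<And>s' e. (\<And>x. x \<notin> {''out'', ''mate'', ''w''} \<Longrightarrow> s' x = s x) \<Longrightarrow> e < nE \<Longrightarrow>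
      s' ''mate'' (s' ''w'' 0) = Suc e \<Longrightarrow> bval b s' \<longleftrightarrow> R (es ! e)"
  shows "runs orc (collect b) s ((100 + bcost b) * Suc nW) (\<lambda>s'.
    mates (s' ''mate'') {x \<in> X. \<not> R x} \<and> represents es {x \<in> X. R x} (read_list (s' ''out'')))"
proof -
  define sel where "sel k = {es ! e | e. e < nE \<and> es ! e \<in> X \<and> R (es ! e) \<and> wend e < k}" for k
  let ?I = "\<lambda>k s'. mates (s' ''mate'') (X - sel k) \<and> represents es (sel k) (read_list (s' ''out''))"
  let ?step = "If (And (Less (Const 0) (Cell ''mate'' (Var ''w''))) b)
         (Seq (Assign ''out'' (Const 0) (Plus (Var ''out'') (Const 1)))
         (Seq (Assign ''out'' (Var ''out'') (Minus (Cell ''mate'' (Var ''w'')) (Const 1)))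
              (Assign ''mate'' (Var ''w'') (Const 0))))
         Skip"
  have XE: "X \<subseteq> edges M"
    using m by (simp add: mates_def)
  have sel_Suc: "sel (Suc k) = sel k \<union> {es ! e | e. e < nE \<and> es ! e \<in> X \<and> R (es ! e) \<and> wend e = k}"
    for k
    unfolding sel_def less_Suc_eq by blast
  have sel0: "sel 0 = {}"
    by (simp add: sel_def)
  have selN: "sel nW = {x \<in> X. R x}"
    using XE wend_less by (auto simp: sel_def) (metis edge_number subsetD)
  have selN': "X - {x \<in> X. R x} = {x \<in> X. \<not> R x}"
    by blast
  have step: "?I (Suc k) (outcome orc ?step s')"
    if k: "k < nW" "s' ''w'' 0 = k" and fr: "\<And>x. x \<notin> {''out'', ''mate'', ''w''} \<Longrightarrow> s' x = s x"
      and I: "?I k s'" for k s'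
  proof (cases "bval (And (Less (Const 0) (Cell ''mate'' (Var ''w''))) b) s'")
    case True
    then obtain e where me: "s' ''mate'' k = Suc e"
      using k(2) by (auto simp: gr0_conv_Suc)
    note e = mates_D[OF conjunct1[OF I] k(1) me]
    have Re: "R (es ! e)"
      using R[OF fr e(1)] me k True by simp
    have one: "es ! e' = es ! e" if "e' < nE" "es ! e' \<in> X" "R (es ! e')" "wend e' = k" for e'
    proof -
      have "es ! e' \<notin> sel k"
        using that nth_eq by (auto simp: sel_def)
      then show ?thesis
        using mates_nth[OF conjunct1[OF I] that(1)] that me by simp
    qed
    have "{es ! e' | e'. e' < nE \<and> es ! e' \<in> X \<and> R (es ! e') \<and> wend e' = k} = {es ! e}" (is "?L = _")
    proof (intro subset_antisym subsetI)
      show "x \<in> {es ! e}" if "x \<in> ?L" for x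
        using that one by blast
      show "x \<in> ?L" if "x \<in> {es ! e}" for x
        using that e Re by blast
    qed
    then have sel: "sel (Suc k) = insert (es ! e) (sel k)"
      unfolding sel_Suc by simp
    let ?o = "outcome orc ?step s'"
    have o: "?o ''mate'' = (s' ''mate'')(k := 0)" "?o ''out'' = (s' ''out'')
        (0 := Suc (s' ''out'' 0), Suc (s' ''out'' 0) := e)"
      using True k(2) me by simp_all
    have "mates (?o ''mate'') (X - sel (Suc k))"
      using mates_remove[OF conjunct1[OF I] k(1) me] unfolding o sel by (subst Diff_insert)
    moreover have "read_list (?o ''out'') = read_list (s' ''out'') @ [e]"
      unfolding o by (rule read_list_append) auto
    then have "represents es (sel (Suc k)) (read_list (?o ''out''))"
      using represents_append[OF conjunct2[OF I] e(1)] e(3) unfolding sel by simp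
    ultimately show ?thesis
      by simp
  next
    case False
    have "\<not> (e < nE \<and> es ! e \<in> X \<and> R (es ! e) \<and> wend e = k)" for e
    proof
      assume e: "e < nE \<and> es ! e \<in> X \<and> R (es ! e) \<and> wend e = k"
      then have "es ! e \<notin> sel k"
        using nth_eq by (auto simp: sel_def)
      then have "s' ''mate'' k = Suc e"
        using mates_nth[OF conjunct1[OF I], of e] e by simp
      then show False
        using R[OF fr, of e] e k False by simp
    qed
    then have "sel (Suc k) = sel k"
      unfolding sel_Suc by blast
    moreover have "outcome orc ?step s' = s'"
      using False unfolding outcome.simps by (simp only: if_False)
    ultimately show ?thesis
      using I by (simp only:)
  qed
  let ?init = "Assign ''out'' (Const 0) (Const 0)"
  have init: "runs orc ?init s (ticks ?init) (\<lambda>s'. s' ''out'' 0 = 0)"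
    by (rule runs_loop_free) simp_all
  have loop: "runs orc (For ''w'' ''nW'' ?step) s1 (nW * (ticks ?step + 12) + 9) (?I nW)"
    if "s1 ''out'' 0 = 0" and fr: "\<And>x. x \<notin> mods ?init \<Longrightarrow> s1 x = s x" for s1
  proof (rule runs_For[where I = ?I])
    show "?I 0 s1"
      using that m by (simp add: sel0 read_list_def represents_def)
    fix k s' assume k: "k < nW" "s' ''w'' 0 = k" and I: "?I k s'"
      and fr': "\<And>x. x \<notin> insert ''w'' (mods ?step) \<Longrightarrow> s' x = s1 x"
    have "s' x = s x" if "x \<notin> {''out'', ''mate'', ''w''}" for x
      using fr[of x] fr'[of x] that by simp
    from step[OF k this I] show "runs orc ?step s' (ticks ?step) (?I (Suc k))"
      by (intro runs_loop_free) simp_all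
  qed (use s fr in \<open>simp_all add: input_def\<close>)
  show ?thesis
    unfolding collect_def
  proof (rule runs_mono[OF runs_Seq[OF init loop]])
    show "ticks ?init + (nW * (ticks ?step + 12) + 9) \<le> (100 + bcost b) * Suc nW"
      by (simp add: algebra_simps)
  qed (simp_all only: selN selN')
qed

text \<open>
  The time depends on \<open>nW\<close> and not on the length of the answer because distinct edges of the answer
  have distinct ends in \<open>W\<close>.
\<close>

lemma runs_refill:
  assumes s: "input s" and m: "mates (s ''mate'') X"
    and r: "represents es Z (read_list (s ''ans''))"
    and XZ: "X \<inter> Z = {}" "inj_on fst (X \<union> Z)"
  shows "runs orc refill s (100 * Suc nW) (\<lambda>s'. mates (s' ''mate'') (X \<union> Z))"
proof -
  define r where "r = read_list (s ''ans'')"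
  have len: "s ''ans'' 0 = length r" and rk: "\<And>k. k < length r \<Longrightarrow> s ''ans'' (Suc k) = r ! k"
    by (auto simp: r_def read_list_def simp del: upt_Suc)
  have rd: "distinct r" "set r \<subseteq> {..<nE}" "(!) es ` set r = Z"
    using r by (auto simp: represents_def r_def)
  let ?I = "\<lambda>k s'. mates (s' ''mate'') (X \<union> (!) es ` set (take k r))"
  have "inj_on wend (set r)"
  proof (rule inj_onI)
    fix e e' assume e: "e \<in> set r" "e' \<in> set r" "wend e = wend e'"
    then have "e < nE" "e' < nE" "es ! e \<in> Z" "es ! e' \<in> Z"
      using rd by auto
    then show "e = e'"
      using e(3) XZ(2) wend_iff nth_eq unfolding inj_on_def by blast
  qed
  then have "length r = card (wend ` set r)"
    using rd(1) by (simp add: card_image distinct_card)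
  also have "\<dots> \<le> card {..<nW}"
    using rd(2) wend_less by (intro card_mono) auto
  finally have len_le: "length r \<le> nW"
    by simp
  have step: "mates (m(wend (r ! k) := Suc (r ! k))) (X \<union> (!) es ` set (take (Suc k) r))"
    if k: "k < length r" and I: "mates m (X \<union> (!) es ` set (take k r))" for k m
  proof -
    have e: "r ! k < nE" "es ! (r ! k) \<in> Z"
      using rd k nth_mem[OF k] by (blast, blast)
    have sub: "(!) es ` set (take k r) \<subseteq> Z"
      using rd(3) set_take_subset[of k r] by blast
    have "r ! k \<notin> set (take k r)"
      using rd(1) k by (auto simp: in_set_conv_nth nth_eq_iff_index_eq)
    then have "es ! (r ! k) \<notin> (!) es ` set (take k r)"
      using rd(2) e(1) nth_eq set_take_subset[of k r] by (auto simp: subset_iff)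
    then have new: "es ! (r ! k) \<notin> X \<union> (!) es ` set (take k r)"
      using e(2) XZ(1) by auto
    have "fst x \<noteq> fst (es ! (r ! k))" if "x \<in> X \<union> (!) es ` set (take k r)" for x
    proof
      assume "fst x = fst (es ! (r ! k))"
      then have "x = es ! (r ! k)"
        using inj_onD[OF XZ(2)] that sub e(2) by blast
      then show False
        using new that by simp
    qed
    from mates_insert[OF I e(1) this] show ?thesis
      using k by (simp add: take_Suc_conv_app_nth)
  qed
  let ?body = "Assign ''mate'' (Cell ''wend'' (Cell ''ans'' (Plus (Var ''k'') (Const 1))))
    (Plus (Cell ''ans'' (Plus (Var ''k'') (Const 1))) (Const 1))"
  have "runs orc refill s (length r * (ticks ?body + 12) + 9) (?I (length r))"
    unfolding refill_def
  proof (rule runs_For[where I = ?I])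
    fix k s' assume k: "k < length r" "s' ''k'' 0 = k" and I: "?I k s'"
      and fr: "\<And>x. x \<notin> insert ''k'' (mods ?body) \<Longrightarrow> s' x = s x"
    then show "runs orc ?body s' (ticks ?body) (?I (Suc k))"
      using s step[OF k(1) I] by (intro runs_loop_free) (simp_all add: input_def rk)
  qed (use m len in simp_all)
  then show ?thesis
    by (rule runs_mono) (use len_le rd(3) in simp_all)
qed

text \<open>
  The termination condition of deferred acceptance, as required by \<open>deferred_X_min\<close>.
\<close>

definition settled :: "('w \<times> 'f) set \<Rightarrow> ('w \<times> 'f) set \<Rightarrow> bool" where
  "settled A X \<longleftrightarrow> (\<forall>e \<in> edges M - A. \<exists>x \<in> X. fst x = fst e)"

lemma settledI:
  assumes p: "proposed p A" and m: "mates m X"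
    and busy: "\<And>w. w < nW \<Longrightarrow> m w = 0 \<Longrightarrow> \<not> p w < woff (Suc w)"
  shows "settled A X"
  unfolding settled_def
proof
  fix x assume "x \<in> edges M - A"
  then obtain e where e: "e < nE" "x = es ! e" "es ! e \<notin> A"
    using edge_number by blast
  obtain k where k: "woff (wend e) \<le> k" "k < woff (Suc (wend e))" "wadj k = e"
    using wadj_all[OF e(1)] by blast
  note w = wend_less[OF e(1)]
  have "\<not> k < p (wend e)"
    using p w k e(3) unfolding proposed_def by blast
  then obtain e' where e': "m (wend e) = Suc e'"
    using busy[OF w] k(2) by (cases "m (wend e)") auto
  then show "\<exists>y \<in> X. fst y = fst x"
    using mates_D[OF m w e'] wend_iff[of e' e] e by blast
qed

lemma next_proposal:
  assumes p: "proposed p A" and w: "w < nW" and open_w: "p w < woff (Suc w)"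
  defines "e \<equiv> wadj (p w)"
  shows next_edge: "e < nE" "wend e = w" "es ! e \<notin> A"
    and next_best: "\<And>x. x \<in> edges M \<Longrightarrow> fst x = fst (es ! e) \<Longrightarrow> x \<notin> A \<Longrightarrow> x \<noteq> es ! e \<Longrightarrow>
      (es ! e, x) \<in> pref M (fst (es ! e))"
    and next_proposed: "proposed (p(w := Suc (p w))) (insert (es ! e) A)"
proof -
  have pw: "woff w \<le> p w"
    and A: "\<And>v k. v < nW \<Longrightarrow> woff v \<le> k \<Longrightarrow> k < woff (Suc v) \<Longrightarrow> es ! wadj k \<in> A \<longleftrightarrow> k < p v"
    and AE: "A \<subseteq> edges M"
    and bounds: "\<And>v. v < nW \<Longrightarrow> woff v \<le> p v \<and> p v \<le> woff (Suc v)"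
    using p w unfolding proposed_def by (blast, blast, blast, blast)
  show e: "e < nE" "wend e = w"
    using wadj_edge[OF w pw open_w] by (simp_all add: e_def)
  show "es ! e \<notin> A"
    using A[OF w pw open_w] by (simp add: e_def)
  show "(es ! e, x) \<in> pref M (fst (es ! e))"
    if x: "x \<in> edges M" "fst x = fst (es ! e)" "x \<notin> A" "x \<noteq> es ! e" for x
  proof -
    obtain j where j: "j < nE" "x = es ! j"
      using x(1) by (rule edge_number)
    then have "wend j = w"
      using x(2) e wend_iff by blast
    then obtain k where k: "woff w \<le> k" "k < woff (Suc w)" "wadj k = j"
      using wadj_all[OF j(1)] by blast
    then have "p w \<le> k" "k \<noteq> p w"
      using A[OF w k(1,2)] x(3,4) j(2) by (auto simp: e_def)
    then show ?thesis
      using wadj_sorted[OF w pw _ k(2)] k(3) j(2) by (simp add: e_def)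
  qed
  have new: "es ! wadj k = es ! e \<longleftrightarrow> v = w \<and> k = p w"
    if v: "v < nW" "woff v \<le> k" "k < woff (Suc v)" for v k
  proof
    assume "es ! wadj k = es ! e"
    then have we: "wadj k = e"
      using wadj_edge[OF v] e(1) nth_eq by blast
    then have vw: "v = w"
      using wadj_edge[OF v] e(2) by simp
    have irr: "(es ! e, es ! e) \<notin> pref M (fst (es ! e))"
      using pref_order(2)[OF valid edge_ends(1)[OF valid nth_edge[OF e(1)]]] by (rule irreflD)
    have "\<not> k < p w" "\<not> p w < k"
      using wadj_sorted[OF w, of k "p w"] wadj_sorted[OF w, of "p w" k] v vw pw open_w we irr
      by (auto simp: e_def)
    then show "v = w \<and> k = p w"
      using vw by simp
  qed (simp add: e_def)
  show "proposed (p(w := Suc (p w))) (insert (es ! e) A)"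
    unfolding proposed_def
  proof (intro conjI allI impI)
    show "insert (es ! e) A \<subseteq> edges M"
      using AE nth_edge[OF e(1)] by blast
    fix v assume v: "v < nW"
    show "woff v \<le> (p(w := Suc (p w))) v" "(p(w := Suc (p w))) v \<le> woff (Suc v)"
      using bounds[OF v] pw open_w by auto
    fix k assume k: "woff v \<le> k" "k < woff (Suc v)"
    show "es ! wadj k \<in> insert (es ! e) A \<longleftrightarrow> k < (p(w := Suc (p w))) v"
      using A[OF v k] new[OF v k] by (auto simp: less_Suc_eq)
  qed
qed

lemma input_cong:
  assumes "input s" "\<And>x. x \<in> {''nW'', ''nE'', ''wend'', ''fend'', ''woff'', ''wadj''} \<Longrightarrow> s' x = s x"
  shows "input s'"
  using assms by (simp add: input_def)

lemma runs_proposal: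
  assumes s: "input s" and m: "mates (s ''mate'') X"
    and u: "s ''u'' 0 < nW" "s ''mate'' (s ''u'' 0) = 0"
    and p: "proposed (s ''ptr'') A" "s ''ptr'' (s ''u'' 0) < woff (Suc (s ''u'' 0))"
  defines "e \<equiv> wadj (s ''ptr'' (s ''u'' 0))"
  defines "f \<equiv> snd (es ! e)"
  shows "runs orc (Seq propose (Seq (collect at_f) (Seq (Ask ''ans'' (Var ''f'') ''out'') refill)))
    s (400 * Suc nW) (\<lambda>s'.
      proposed (s' ''ptr'') (insert (es ! e) A) \<and>
      mates (s' ''mate'') (X - edges_at M (Inr f) \<union>
        choice M f (insert (es ! e) (X \<inter> edges_at M (Inr f)))))"
proof -
  let ?u = "s ''u'' 0"
  let ?J = "insert (es ! e) X"
  let ?Z = "{x \<in> ?J. snd x = f}"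
  note next_e = next_proposal[OF p(1) u(1) p(2), folded e_def]
  have J: "mates ((s ''mate'')(?u := Suc e)) ?J"
    by (rule mates_insert[OF m next_e(1) mates_free[OF m u next_e(1,2)], unfolded next_e(2)])
  have JE: "?J \<subseteq> edges M"
    using J by (simp add: mates_def)
  have f: "f \<in> fside M"
    unfolding f_def by (rule edge_ends(2)[OF valid nth_edge[OF next_e(1)]])
  have Z: "?Z \<subseteq> edges_at M (Inr f)" "?Z = insert (es ! e) (X \<inter> edges_at M (Inr f))"
    "{x \<in> ?J. snd x \<noteq> f} = X - edges_at M (Inr f)"
    using JE by (auto simp: f_def)
  have CZ: "choice M f ?Z \<subseteq> ?Z"
    by (rule choice_subset[OF valid f Z(1)])
  have ask: "runs orc (Seq (Ask ''ans'' (Var ''f'') ''out'') refill) s' (3 + 100 * Suc nW)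
      (\<lambda>s''. mates (s'' ''mate'') ({x \<in> ?J. snd x \<noteq> f} \<union> choice M f ?Z))"
    if s': "input s'" "s' ''f'' 0 = fend e" "mates (s' ''mate'') {x \<in> ?J. snd x \<noteq> f}"
      "represents es ?Z (read_list (s' ''out''))" for s'
  proof (rule runs_Seq)
    have "represents es (choice M f ?Z) (orc (fend e) (read_list (s' ''out'')))"
      using orc_choice[OF next_e(1), of ?Z] Z(1) s'(4) unfolding f_def by blast
    then have "runs orc (Ask ''ans'' (Var ''f'') ''out'') s' (ticks (Ask ''ans'' (Var ''f'') ''out''))
      (\<lambda>s''. represents es (choice M f ?Z) (read_list (s'' ''ans'')))"
      using s'(2) by (intro runs_loop_free) (simp_all add: read_write_list)
    then show "runs orc (Ask ''ans'' (Var ''f'') ''out'') s' 3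
      (\<lambda>s''. represents es (choice M f ?Z) (read_list (s'' ''ans'')))"
      by (rule runs_mono) simp_all
    fix s'' assume r: "represents es (choice M f ?Z) (read_list (s'' ''ans''))"
      and fr: "\<And>x. x \<notin> mods (Ask ''ans'' (Var ''f'') ''out'') \<Longrightarrow> s'' x = s' x"
    show "runs orc refill s'' (100 * Suc nW)
      (\<lambda>s''. mates (s'' ''mate'') ({x \<in> ?J. snd x \<noteq> f} \<union> choice M f ?Z))"
    proof (rule runs_refill)
      show "input s''"
        by (rule input_cong[OF s'(1)]) (rule fr, auto)
      show "mates (s'' ''mate'') {x \<in> ?J. snd x \<noteq> f}"
        using s'(3) fr[of "''mate''"] by simp
      show "{x \<in> ?J. snd x \<noteq> f} \<inter> choice M f ?Z = {}"
        using CZ by blast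
      show "represents es (choice M f ?Z) (read_list (s'' ''ans''))"
        by (rule r)
      show "inj_on fst ({x \<in> ?J. snd x \<noteq> f} \<union> choice M f ?Z)"
        using CZ by (intro inj_on_subset[OF mates_inj[OF J]]) blast
    qed
  qed
  have coll: "runs orc (Seq (collect at_f) (Seq (Ask ''ans'' (Var ''f'') ''out'') refill)) s'
      (110 * Suc nW + (3 + 100 * Suc nW))
      (\<lambda>s''. mates (s'' ''mate'') ({x \<in> ?J. snd x \<noteq> f} \<union> choice M f ?Z))"
    if s': "input s'" "s' ''f'' 0 = fend e" "mates (s' ''mate'') ?J" for s'
  proof (rule runs_Seq)
    have "runs orc (collect at_f) s' ((100 + bcost at_f) * Suc nW) (\<lambda>s''.
      mates (s'' ''mate'') {x \<in> ?J. \<not> snd x = f} \<and>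
      represents es {x \<in> ?J. snd x = f} (read_list (s'' ''out'')))"
    proof (rule runs_collect[OF s'(1,3)])
      fix s'' j assume fr: "\<And>x. x \<notin> {''out'', ''mate'', ''w''} \<Longrightarrow> s'' x = s' x"
        and j: "j < nE" "s'' ''mate'' (s'' ''w'' 0) = Suc j"
      show "bval at_f s'' \<longleftrightarrow> snd (es ! j) = f"
        using fr[of "''fend''"] fr[of "''f''"] s'(1,2) j fend_iff[OF j(1) next_e(1)]
        by (simp add: at_f_def input_def f_def)
    qed
    then show "runs orc (collect at_f) s' (110 * Suc nW) (\<lambda>s''.
      mates (s'' ''mate'') {x \<in> ?J. snd x \<noteq> f} \<and> represents es ?Z (read_list (s'' ''out'')))"
      by (rule runs_mono) (simp_all add: at_f_def)
    fix s'' assume r: "mates (s'' ''mate'') {x \<in> ?J. snd x \<noteq> f} \<and>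
        represents es ?Z (read_list (s'' ''out''))"
      and fr: "\<And>x. x \<notin> mods (collect at_f) \<Longrightarrow> s'' x = s' x"
    show "runs orc (Seq (Ask ''ans'' (Var ''f'') ''out'') refill) s'' (3 + 100 * Suc nW)
      (\<lambda>s''. mates (s'' ''mate'') ({x \<in> ?J. snd x \<noteq> f} \<union> choice M f ?Z))"
    proof (rule ask)
      show "input s''"
        by (rule input_cong[OF s'(1)]) (rule fr, auto)
      show "s'' ''f'' 0 = fend e"
        using fr[of "''f''"] s'(2) by simp
    qed (use r in blast)+
  qed
  have "runs orc (Seq propose (Seq (collect at_f) (Seq (Ask ''ans'' (Var ''f'') ''out'') refill)))
    s (ticks propose + (110 * Suc nW + (3 + 100 * Suc nW))) (\<lambda>s'.
      s' ''ptr'' = (s ''ptr'')(?u := Suc (s ''ptr'' ?u)) \<and>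
      mates (s' ''mate'') ({x \<in> ?J. snd x \<noteq> f} \<union> choice M f ?Z))"
  proof (rule runs_Seq)
    show "runs orc propose s (ticks propose) (\<lambda>s'.
        s' ''ptr'' = (s ''ptr'')(?u := Suc (s ''ptr'' ?u)) \<and>
        s' ''mate'' = (s ''mate'')(?u := Suc e) \<and> s' ''f'' 0 = fend e)"
      using s by (intro runs_loop_free) (simp_all add: propose_def input_def e_def)
    fix s' assume r: "s' ''ptr'' = (s ''ptr'')(?u := Suc (s ''ptr'' ?u)) \<and>
        s' ''mate'' = (s ''mate'')(?u := Suc e) \<and> s' ''f'' 0 = fend e"
      and fr: "\<And>x. x \<notin> mods propose \<Longrightarrow> s' x = s x"
    have "input s'"
      by (rule input_cong[OF s]) (rule fr, auto)
    moreover have "mates (s' ''mate'') ?J"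
      using r J by simp
    ultimately have c: "runs orc (Seq (collect at_f) (Seq (Ask ''ans'' (Var ''f'') ''out'') refill)) s'
      (110 * Suc nW + (3 + 100 * Suc nW))
      (\<lambda>s''. mates (s'' ''mate'') ({x \<in> ?J. snd x \<noteq> f} \<union> choice M f ?Z))"
      using coll r by blast
    show "runs orc (Seq (collect at_f) (Seq (Ask ''ans'' (Var ''f'') ''out'') refill)) s'
      (110 * Suc nW + (3 + 100 * Suc nW))
      (\<lambda>s''. s'' ''ptr'' = (s ''ptr'')(?u := Suc (s ''ptr'' ?u)) \<and>
        mates (s'' ''mate'') ({x \<in> ?J. snd x \<noteq> f} \<union> choice M f ?Z))"
    proof (rule runs_mono[OF c order_refl])
      fix s'' assume "mates (s'' ''mate'') ({x \<in> ?J. snd x \<noteq> f} \<union> choice M f ?Z)"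
        and "\<And>x. x \<notin> mods (Seq (collect at_f) (Seq (Ask ''ans'' (Var ''f'') ''out'') refill)) \<Longrightarrow>
          s'' x = s' x"
      then show "s'' ''ptr'' = (s ''ptr'')(?u := Suc (s ''ptr'' ?u)) \<and>
        mates (s'' ''mate'') ({x \<in> ?J. snd x \<noteq> f} \<union> choice M f ?Z)"
        using r by simp
    qed
  qed
  then show ?thesis
    unfolding Z(2,3) by (rule runs_mono) (use next_e(5) in \<open>simp_all add: propose_def\<close>)
qed

text \<open>
  The invariant of the main loop. After \<open>nE\<close> rounds the second alternative leaves no edge
  unproposed, so both alternatives give the termination condition.
\<close>

definition progress :: "nat \<Rightarrow> state \<Rightarrow> bool" where
  "progress k s \<longleftrightarrow> (\<exists>A X. deferred M A X \<and> proposed (s ''ptr'') A \<and> mates (s ''mate'') X \<and>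
     (settled A X \<or> k \<le> card A))"

lemma runs_round:
  assumes s: "input s" and k: "progress k s"
  shows "runs orc round s (600 * Suc nW) (progress (Suc k))"
proof -
  obtain A X where AX: "deferred M A X" and A: "proposed (s ''ptr'') A" and X: "mates (s ''mate'') X"
    and k: "settled A X \<or> k \<le> card A"
    using k unfolding progress_def by blast
  have "runs orc round s (100 * Suc nW + (5 + 400 * Suc nW + 1)) (progress (Suc k))"
    unfolding round_def
  proof (rule runs_Seq[OF runs_find_free[OF s]])
    fix s1
    assume u: "s1 ''u'' 0 = nW \<and> (\<forall>w < nW. s ''mate'' w = 0 \<longrightarrow> \<not> s ''ptr'' w < woff (Suc w)) \<or>
        s1 ''u'' 0 < nW \<and> s ''mate'' (s1 ''u'' 0) = 0 \<and>
          s ''ptr'' (s1 ''u'' 0) < woff (Suc (s1 ''u'' 0))"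
      and fr: "\<And>x. x \<notin> mods find_free \<Longrightarrow> s1 x = s x"
    have s1: "s1 ''mate'' = s ''mate''" "s1 ''ptr'' = s ''ptr''"
      by (simp_all add: fr)
    have in1: "input s1"
      by (rule input_cong[OF s]) (rule fr, auto)
    let ?p = "Seq propose (Seq (collect at_f) (Seq (Ask ''ans'' (Var ''f'') ''out'') refill))"
    have "runs orc (If (Less (Var ''u'') (Var ''nW'')) ?p Skip) s1
      (bcost (Less (Var ''u'') (Var ''nW'')) + 400 * Suc nW + 1) (progress (Suc k))"
    proof (rule runs_If)
      assume "bval (Less (Var ''u'') (Var ''nW'')) s1"
      then have u': "s1 ''u'' 0 < nW" "s1 ''mate'' (s1 ''u'' 0) = 0"
        "s1 ''ptr'' (s1 ''u'' 0) < woff (Suc (s1 ''u'' 0))"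
        using u in1 s1 by (auto simp: input_def)
      define e where "e = wadj (s1 ''ptr'' (s1 ''u'' 0))"
      have A1: "proposed (s1 ''ptr'') A" and X1: "mates (s1 ''mate'') X"
        using A X s1 by simp_all
      note e = next_proposal[OF A1 u'(1,3), folded e_def]
      note free = mates_free[OF X1 u'(1,2) e(1,2)]
      let ?X = "X - edges_at M (Inr (snd (es ! e))) \<union>
        choice M (snd (es ! e)) (insert (es ! e) (X \<inter> edges_at M (Inr (snd (es ! e)))))"
      have d: "deferred M (insert (es ! e) A) ?X"
        by (rule deferred_propose[OF valid AX nth_edge[OF e(1)] e(3) free e(4)])
      \<comment> \<open>A free vertex with an unproposed edge excludes the first alternative, so the count of
        proposals is known and increases.\<close>
      have "\<not> settled A X"
        using free nth_edge[OF e(1)] e(3) unfolding settled_def by blast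
      moreover have "finite A"
        using deferredD(1)[OF AX] es(2) by (metis finite_set finite_subset)
      ultimately have c: "Suc k \<le> card (insert (es ! e) A)"
        using k e(3) by simp
      show "runs orc ?p s1 (400 * Suc nW) (progress (Suc k))"
        by (rule runs_mono[OF runs_proposal[OF in1 X1 u'(1,2) A1 u'(3), folded e_def] order_refl])
          (use d c in \<open>unfold progress_def, blast\<close>)
    next
      assume "\<not> bval (Less (Var ''u'') (Var ''nW'')) s1"
      then have "\<forall>w < nW. s ''mate'' w = 0 \<longrightarrow> \<not> s ''ptr'' w < woff (Suc w)"
        using u in1 by (auto simp: input_def)
      then have "settled A X"
        using settledI[OF A X] by blast
      then have "progress (Suc k) s1"
        using AX A X unfolding progress_def s1 by blast
      then have "runs orc Skip s1 (ticks Skip) (progress (Suc k))"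
        by (intro runs_loop_free) simp_all
      then show "runs orc Skip s1 (400 * Suc nW) (progress (Suc k))"
        by (rule runs_mono) simp_all
    qed
    then show "runs orc (If (Less (Var ''u'') (Var ''nW'')) ?p Skip) s1
      (5 + 400 * Suc nW + 1) (progress (Suc k))"
      by (simp add: eval_nat_numeral)
  qed
  then show ?thesis
    by (rule runs_mono) simp_all
qed

lemma runs_deferred_acceptance:
  assumes s: "input s"
  shows "runs orc deferred_acceptance s (1000 * (Suc nE * Suc nW))
    (\<lambda>s'. \<exists>X. represents es X (read_list (s' ''out'')) \<and> is_X_min M X)"
proof -
  let ?init = "Seq (Assign ''ptr'' (Var ''w'') (Cell ''woff'' (Var ''w'')))
    (Assign ''mate'' (Var ''w'') (Const 0))"
  let ?I = "\<lambda>k s'. \<forall>w < k. s' ''ptr'' w = woff w \<and> s' ''mate'' w = 0"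
  have init: "runs orc (For ''w'' ''nW'' ?init) s (nW * (ticks ?init + 12) + 9) (?I nW)"
  proof (rule runs_For[where I = ?I])
    fix k s' assume "s' ''w'' 0 = k" "\<And>x. x \<notin> insert ''w'' (mods ?init) \<Longrightarrow> s' x = s x" "?I k s'"
    then show "runs orc ?init s' (ticks ?init) (?I (Suc k))"
      using s by (intro runs_loop_free) (auto simp: input_def less_Suc_eq)
  qed (use s in \<open>simp_all add: input_def\<close>)
  have rest: "runs orc (Seq (For ''r'' ''nE'' round) (collect everything)) s1
      ((nE * (600 * Suc nW + 12) + 9) + (100 + bcost everything) * Suc nW)
      (\<lambda>s'. \<exists>X. represents es X (read_list (s' ''out'')) \<and> is_X_min M X)"
    if I: "?I nW s1" and fr: "\<And>x. x \<notin> mods (For ''w'' ''nW'' ?init) \<Longrightarrow> s1 x = s x" for s1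
  proof (rule runs_Seq)
    have in1: "input s1"
      by (rule input_cong[OF s]) (rule fr, auto)
    have "proposed (s1 ''ptr'') {}" "mates (s1 ''mate'') {}"
      using I woff_mono wend_less by (auto simp: proposed_def mates_def)
    then have "progress 0 s1"
      using deferred_empty[OF valid] unfolding progress_def by blast
    then show "runs orc (For ''r'' ''nE'' round) s1 (nE * (600 * Suc nW + 12) + 9) (progress nE)"
    proof (intro runs_For[where I = progress])
      fix k s' assume fr': "\<And>x. x \<notin> insert ''r'' (mods round) \<Longrightarrow> s' x = s1 x" and k: "progress k s'"
      have "input s'"
        by (rule input_cong[OF in1]) (rule fr', auto)
      then show "runs orc round s' (600 * Suc nW) (progress (Suc k))"
        using runs_round k by blast
    qed (use in1 in \<open>auto simp: input_def progress_def\<close>)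
    fix s2 assume "progress nE s2" and fr': "\<And>x. x \<notin> mods (For ''r'' ''nE'' round) \<Longrightarrow> s2 x = s1 x"
    then obtain A X where AX: "deferred M A X" "mates (s2 ''mate'') X" "settled A X \<or> nE \<le> card A"
      unfolding progress_def by blast
    have "settled A X"
    proof (cases "nE \<le> card A")
      case True
      have "card (edges M) = nE" "finite (edges M)"
        using es by (metis distinct_card, metis finite_set)
      then have "A = edges M"
        using True deferredD(1)[OF AX(1)] by (intro card_seteq) auto
      then show ?thesis
        by (simp add: settled_def)
    qed (use AX in blast)
    then have X_min: "is_X_min M X"
      using deferred_X_min[OF valid AX(1)] unfolding settled_def by blast
    have "input s2"
      by (rule input_cong[OF in1]) (rule fr', auto)
    then have "runs orc (collect everything) s2 ((100 + bcost everything) * Suc nW)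
      (\<lambda>s'. mates (s' ''mate'') {x \<in> X. \<not> True} \<and> represents es {x \<in> X. True} (read_list (s' ''out'')))"
      using AX(2) by (rule runs_collect) (simp add: everything_def)
    then show "runs orc (collect everything) s2 ((100 + bcost everything) * Suc nW)
      (\<lambda>s'. \<exists>X. represents es X (read_list (s' ''out'')) \<and> is_X_min M X)"
      by (rule runs_mono) (use X_min in auto)
  qed
  show ?thesis
    unfolding deferred_acceptance_def
    by (rule runs_mono[OF runs_Seq[OF init rest]]) (simp_all add: everything_def algebra_simps)
qed

end

section \<open>Decoding the input\<close>

lemma stores_lists_nth:
  assumes "stores_lists s off x xss" "i < length xss"
  shows "s off (Suc i) = s off i + length (xss ! i)"
    and "j < length (xss ! i) \<Longrightarrow> s x (s off i + j) = xss ! i ! j"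
proof -
  have off: "\<And>i. i \<le> length xss \<Longrightarrow> s off i = length (concat (take i xss))"
    and x: "\<And>k. k < length (concat xss) \<Longrightarrow> s x k = concat xss ! k"
    using assms(1) by (auto simp: stores_lists_def)
  show "s off (Suc i) = s off i + length (xss ! i)"
    using off[of i] off[of "Suc i"] assms(2) by (simp add: take_Suc_conv_app_nth)
  have "concat xss = concat (take i xss) @ xss ! i @ concat (drop (Suc i) xss)"
    using arg_cong[OF id_take_nth_drop[OF assms(2)], of concat] by simp
  then show "s x (s off i + j) = xss ! i ! j" if "j < length (xss ! i)"
    using x[of "s off i + j"] off[of i] assms(2) that by (simp add: nth_append)
qed

lemma encodes_numbered_market:
  assumes valid: "valid_market M" and enc: "encodes M ws fs es s" and orc: "oracle_for M fs es orc"
  shows "numbered_market M es (s ''nW'' 0) (s ''wend'') (s ''fend'') (s ''woff'') (s ''wadj'') orc"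
proof -
  have ws: "distinct ws" "s ''nW'' 0 = length ws" and fs: "distinct fs"
    and es: "distinct es" "set es = edges M"
    and ends: "\<And>j. j < length es \<Longrightarrow> s ''wend'' j < length ws \<and> s ''fend'' j < length fs \<and>
        es ! j = (ws ! s ''wend'' j, fs ! s ''fend'' j)"
    using enc unfolding encodes_def by blast+
  obtain wl where wl: "length wl = length ws" "stores_lists s ''woff'' ''wadj'' wl"
    and wli: "\<And>i. i < length ws \<Longrightarrow> represents es (edges_at M (Inl (ws ! i))) (wl ! i) \<and>
           sorted_wrt (\<lambda>j k. (es ! j, es ! k) \<in> pref M (ws ! i)) (wl ! i)"
    using enc unfolding encodes_def by blast
  have off: "s ''woff'' (Suc i) = s ''woff'' i + length (wl ! i)" if "i < length ws" for i
    using stores_lists_nth(1)[OF wl(2)] that wl(1) by simp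
  have adj: "s ''wadj'' k = wl ! i ! (k - s ''woff'' i)" "k - s ''woff'' i < length (wl ! i)"
    if "i < length ws" "s ''woff'' i \<le> k" "k < s ''woff'' (Suc i)" for i k
    using stores_lists_nth(2)[OF wl(2), of i "k - s ''woff'' i"] off[of i] that wl(1) by simp_all
  have edge: "wl ! i ! k < length es \<and> s ''wend'' (wl ! i ! k) = i"
    if i: "i < length ws" and k: "k < length (wl ! i)" for i k
  proof -
    have mem: "wl ! i ! k \<in> set (wl ! i)"
      using k by (rule nth_mem)
    then have *: "wl ! i ! k < length es" "es ! (wl ! i ! k) \<in> edges_at M (Inl (ws ! i))"
      using wli[OF i] by (auto simp: represents_def)
    then have "ws ! s ''wend'' (wl ! i ! k) = ws ! i"
      using ends[OF *(1)] by simp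
    then show ?thesis
      using * ends[OF *(1)] i ws(1) nth_eq_iff_index_eq by blast
  qed
  show ?thesis
    unfolding ws(2)
  proof
    show "valid_market M" "distinct es" "set es = edges M"
      by fact+
    show "s ''wend'' j < length ws" if "j < length es" for j
      using ends[OF that] by simp
    show "fst (es ! i) = fst (es ! j) \<longleftrightarrow> s ''wend'' i = s ''wend'' j"
      if "i < length es" "j < length es" for i j
      using ends[OF that(1)] ends[OF that(2)] ws(1) nth_eq_iff_index_eq by fastforce
    show "snd (es ! i) = snd (es ! j) \<longleftrightarrow> s ''fend'' i = s ''fend'' j"
      if "i < length es" "j < length es" for i j
      using ends[OF that(1)] ends[OF that(2)] fs nth_eq_iff_index_eq by fastforce
    show "s ''woff'' w \<le> s ''woff'' (Suc w)" if "w < length ws" for w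
      using off[OF that] by simp
    show "s ''wadj'' k < length es \<and> s ''wend'' (s ''wadj'' k) = w"
      if "w < length ws" "s ''woff'' w \<le> k" "k < s ''woff'' (Suc w)" for w k
      using adj[OF that] edge[OF that(1)] by simp
    show "\<exists>k. s ''woff'' (s ''wend'' j) \<le> k \<and> k < s ''woff'' (Suc (s ''wend'' j)) \<and> s ''wadj'' k = j"
      if j: "j < length es" for j
    proof -
      let ?i = "s ''wend'' j"
      have i: "?i < length ws"
        using ends[OF j] by simp
      have "es ! j \<in> edges_at M (Inl (ws ! ?i))"
        using ends[OF j] nth_mem[OF j] es(2) by simp
      then have "es ! j \<in> (!) es ` set (wl ! ?i)"
        using wli[OF i] by (simp add: represents_def)
      then obtain j' where j': "j' \<in> set (wl ! ?i)" "es ! j = es ! j'"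
        by blast
      then have "j' < length es"
        using wli[OF i] by (auto simp: represents_def)
      then have "j \<in> set (wl ! ?i)"
        using es(1) j j' nth_eq_iff_index_eq by metis
      then obtain l where "l < length (wl ! ?i)" "wl ! ?i ! l = j"
        by (auto simp: in_set_conv_nth)
      then show ?thesis
        using off[OF i] stores_lists_nth(2)[OF wl(2), of ?i l] i wl(1)
        by (intro exI[of _ "s ''woff'' ?i + l"]) simp
    qed
    show "(es ! s ''wadj'' k, es ! s ''wadj'' l) \<in> pref M (fst (es ! s ''wadj'' k))"
      if w: "w < length ws" "s ''woff'' w \<le> k" "k < l" "l < s ''woff'' (Suc w)" for w k l
    proof -
      have k: "k < s ''woff'' (Suc w)" and l: "s ''woff'' w \<le> l"
        using w by simp_all
      have "(es ! s ''wadj'' k, es ! s ''wadj'' l) \<in> pref M (ws ! w)"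
        using sorted_wrt_nth_less[OF conjunct2[OF wli[OF w(1)]], of "k - s ''woff'' w" "l - s ''woff'' w"]
          adj[OF w(1,2) k] adj[OF w(1) l w(4)] w by simp
      then show ?thesis
        using edge[OF w(1) adj(2)[OF w(1,2) k]] adj(1)[OF w(1,2) k] ends by simp
    qed
    show "represents es (choice M (snd (es ! j)) Z) (orc (s ''fend'' j) zs)"
      if "j < length es" "Z \<subseteq> edges_at M (Inr (snd (es ! j)))" "represents es Z zs" for j Z zs
      using orc ends[OF that(1)] that(2,3) unfolding oracle_for_def by simp
  qed
qed

theorem mainTheorem7:
  shows "\<exists>(prog :: com) (c :: nat).
    \<forall>(M :: ('w, 'f) market) ws fs es orc s.
      valid_market M \<longrightarrow> encodes M ws fs es s \<longrightarrow> oracle_for M fs es orc \<longrightarrow>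
      (\<exists>t s' X. exec orc prog s t s' \<and>
         represents es X (read_list (s' ''out'')) \<and> is_X_min M X \<and>
         (edges M \<noteq> {} \<longrightarrow> t \<le> c * (card (edges M) * card (verts M))))"
proof (rule exI[of _ deferred_acceptance], rule exI[of _ 2000], intro allI impI)
  fix M :: "('w, 'f) market" and ws fs es orc s
  assume valid: "valid_market M" and enc: "encodes M ws fs es s" and orc: "oracle_for M fs es orc"
  interpret numbered_market M es "s ''nW'' 0" "s ''wend''" "s ''fend''" "s ''woff''" "s ''wadj''" orc
    by (rule encodes_numbered_market[OF valid enc orc])
  have nE: "s ''nE'' 0 = length es" and nW: "s ''nW'' 0 = card (wside M)"
    using enc unfolding encodes_def by (blast, metis distinct_card)
  have "input s"
    by (simp add: input_def nE)
  then obtain t s' X where run: "exec orc deferred_acceptance s t s'"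
    "represents es X (read_list (s' ''out''))" "is_X_min M X"
    and t: "t \<le> 1000 * (Suc nE * Suc (s ''nW'' 0))"
    using runs_deferred_acceptance unfolding runs_def by blast
  have "t \<le> 2000 * (card (edges M) * card (verts M))" if ne: "edges M \<noteq> {}"
  proof -
    have E: "card (edges M) = nE"
      using es by (metis distinct_card)
    have "es \<noteq> []"
      using es(2) ne by auto
    then have pos: "nE > 0"
      by (rule length_greater_0_conv[THEN iffD2])
    have fin: "finite (wside M)" "finite (fside M)"
      using valid by (simp_all add: valid_market_def)
    obtain e where "e \<in> edges M"
      using ne by blast
    then have "card (fside M) > 0"
      using edge_ends(2)[OF valid] fin(2) card_gt_0_iff by blast
    then have "Suc (s ''nW'' 0) \<le> card (verts M)"
      using fin by (simp add: verts_def card_Plus nW)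
    \<comment> \<open>There is an edge, so one more round and, by the vertex in \<open>F\<close>, one more vertex are
      absorbed by the constant.\<close>
    moreover have "Suc nE \<le> 2 * nE"
      using pos by linarith
    ultimately have "Suc nE * Suc (s ''nW'' 0) \<le> (2 * nE) * card (verts M)"
      by (rule mult_le_mono[rotated])
    then show ?thesis
      using t E by simp
  qed
  then show "\<exists>t s' X. exec orc deferred_acceptance s t s' \<and>
         represents es X (read_list (s' ''out'')) \<and> is_X_min M X \<and>
         (edges M \<noteq> {} \<longrightarrow> t \<le> 2000 * (card (edges M) * card (verts M)))"
    using run by blast
qed

end
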